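(* Let $f\colon M\to\mathbb{R}^{2n+2}$ be an affine hypersurface with a $\widetilde J$-tangent transversal vector field $C$, let $\nabla$ be the affine connection induced by $C$ and $(\varphi,\xi,\eta)$ the almost paracontact structure on $M$ induced by $C$. If $\nabla\varphi=0$ or $\nabla\eta=0$, then for every $p\in M$ there exist a neighbourhood $U$ of $p$ and local coordinates $(x_1,\ldots,x_{2n},y)$ on $U$ in which $f$ has the form $$f(x_1,\ldots,x_{2n},y)=x_1b_1+\cdots+x_{2n}b_{2n}+\widetilde Jv\int\cosh\alpha(y)\,dy+v\int\sinh\alpha(y)\,dy,\qquad( * )$$ where $b_1,\ldots,b_{2n},v\in\mathbb{R}^{2n+2}$ are such that $b_1,\ldots,b_{2n},v,\widetilde Jv$ are linearly independent, $\widetilde Jb_i=b_i$ for $i=1,\ldots,n$, $\widetilde Jb_i=-b_i$ for $i=n+1,\ldots,2n$, and $\alpha$ is some smooth function of one variable. Conversely, for every function $f$ of the form $( * )$, with $b_1,\ldots,b_{2n},v$ and a smooth function $\alpha$ satisfying the conditions above, $f$ is an immersion and there exists a $\widetilde J$-tangent equiaffine transversal vector field $C$ defined on the whole domain of $f$ such that the induced almost paracontact structure $(\varphi,\xi,\eta)$ is $\nabla$-parallel for the induced connection $\nabla$.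
   Context: All objects are smooth. The space $\mathbb{R}^{2n+2}$ carries its standard flat connection $D$ and the para-complex structure $\widetilde J(x_1,\ldots,x_{n+1},y_1,\ldots,y_{n+1})=(y_1,\ldots,y_{n+1},x_1,\ldots,x_{n+1})$. An affine hypersurface $f\colon M\to\mathbb{R}^{2n+2}$ is an immersion of an orientable connected manifold $M$ of dimension $2n+1$. A transversal vector field $C$ (an $\mathbb{R}^{2n+2}$-valued function on $M$ with $C_x\notin f_*(T_xM)$ for all $x$) induces a torsion-free connection $\nabla$, a symmetric bilinear form $h$, a $(1,1)$-tensor $S$ and a 1-form $\tau$ via $D_Xf_*Y=f_*(\nabla_XY)+h(X,Y)C$ and $D_XC=-f_*(SX)+\tau(X)C$. It is called equiaffine if $\tau=0$, and $\widetilde J$-tangent if $\widetilde JC_x\in f_*(T_xM)$ for every $x\in M$. Let $\mathcal D_x=f_*^{-1}\big(f_*(T_xM)\cap\widetilde J(f_*(T_xM))\big)$; when a $\widetilde J$-tangent transversal vector field exists, $\mathcal D$ is a distribution of rank $2n$, invariant under $\widetilde J$ (identifying tangent vectors with their images under $f_*$). The almost paracontact structure $(\varphi,\xi,\eta)$ induced by a $\widetilde J$-tangent transversal vector field $C$ is defined by: $\xi$ is the tangent vector field with $f_*\xi=\widetilde JC$; $\eta$ is the 1-form with $\eta|_{\mathcal D}=0$, $\eta(\xi)=1$; $\varphi$ is the $(1,1)$-tensor with $\varphi|_{\mathcal D}=\widetilde J|_{\mathcal D}$, $\varphi(\xi)=0$. It is called $\nabla$-parallel if $\nabla\varphi=0$,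 $\nabla\eta=0$ and $\nabla\xi=0$. The symbols $\int\cosh\alpha(y)\,dy$ and $\int\sinh\alpha(y)\,dy$ denote antiderivatives of $\cosh\alpha$ and $\sinh\alpha$. In the converse part, $\alpha$ is defined on an open interval $I$ and $f$ on a connected open subset of $\mathbb{R}^{2n}\times I$. *)

theory Defs
  imports "HOL-Analysis.Analysis"
begin

section \<open>Smooth maps and smooth manifolds\<close>

fun higher_differentiable_on ::
  "nat \<Rightarrow> 'a::real_normed_vector set \<Rightarrow> ('a \<Rightarrow> 'b::real_normed_vector) \<Rightarrow> bool" where
  "higher_differentiable_on 0 S f \<longleftrightarrow> continuous_on S f"
| "higher_differentiable_on (Suc k) S f \<longleftrightarrow>
     (\<forall>x\<in>S. f differentiable (at x)) \<and>
     (\<forall>v. higher_differentiable_on k S (\<lambda>x. frechet_derivative f (at x) v))"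

text \<open>Only used for open sets \<open>S\<close>.\<close>

definition smooth_on :: "'a::real_normed_vector set \<Rightarrow> ('a \<Rightarrow> 'b::real_normed_vector) \<Rightarrow> bool" where
  "smooth_on S f \<longleftrightarrow> (\<forall>k. higher_differentiable_on k S f)"

text \<open>A chart is a pair \<open>(U, \<kappa>)\<close>; the values of \<open>\<kappa>\<close> outside \<open>U\<close> are irrelevant.\<close>

type_synonym ('m, 'e) chart = "'m set \<times> ('m \<Rightarrow> 'e)"

definition chart_inv :: "('m, 'e) chart \<Rightarrow> 'e \<Rightarrow> 'm" where
  "chart_inv c = inv_into (fst c) (snd c)"

definition chart_image :: "('m, 'e) chart \<Rightarrow> 'e set" where
  "chart_image c = snd c ` fst c"

definition is_chart :: "('m::topological_space, 'e::topological_space) chart \<Rightarrow> bool" where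
  "is_chart c \<longleftrightarrow> open (fst c) \<and> open (chart_image c) \<and>
     homeomorphism (fst c) (chart_image c) (snd c) (chart_inv c)"

definition transition :: "('m, 'e) chart \<Rightarrow> ('m, 'e) chart \<Rightarrow> 'e \<Rightarrow> 'e" where
  "transition c c' = snd c' \<circ> chart_inv c"

definition overlap :: "('m, 'e) chart \<Rightarrow> ('m, 'e) chart \<Rightarrow> 'e set" where
  "overlap c c' = snd c ` (fst c \<inter> fst c')"

definition compatible ::
  "('m, 'e::real_normed_vector) chart \<Rightarrow> ('m, 'e) chart \<Rightarrow> bool" where
  "compatible c c' \<longleftrightarrow> smooth_on (overlap c c') (transition c c')
                    \<and> smooth_on (overlap c' c) (transition c' c)"

text \<open>The underlying space \<open>M\<close> of a manifold is an open subset of a second countable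
  Hausdorff space; a manifold that is a whole type is the case \<open>M = UNIV\<close>.\<close>

definition smooth_atlas ::
  "'m::{t2_space, second_countable_topology} set \<Rightarrow> ('m, 'e::euclidean_space) chart set \<Rightarrow> bool" where
  "smooth_atlas M A \<longleftrightarrow> (\<forall>c\<in>A. is_chart c) \<and> (\<Union>c\<in>A. fst c) = M \<and>
     (\<forall>c\<in>A. \<forall>c'\<in>A. compatible c c')"

text \<open>The charts of the maximal atlas containing \<open>A\<close>, i.e. all local coordinate systems.\<close>

definition local_coordinates ::
  "'m::{t2_space, second_countable_topology} set \<Rightarrow> ('m, 'e::euclidean_space) chart set
    \<Rightarrow> ('m, 'e) chart set" where
  "local_coordinates M A = {c. is_chart c \<and> fst c \<subseteq> M \<and> (\<forall>c'\<in>A. compatible c c')}"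

definition orientable ::
  "'m::{t2_space, second_countable_topology} set \<Rightarrow> ('m, real^'d) chart set \<Rightarrow> bool" where
  "orientable M A \<longleftrightarrow> (\<exists>B \<subseteq> local_coordinates M A. smooth_atlas M B \<and>
     (\<forall>c\<in>B. \<forall>c'\<in>B. \<forall>z\<in>overlap c c'.
        det (matrix (frechet_derivative (transition c c') (at z))) > 0))"

section \<open>Hypersurfaces in coordinates\<close>

text \<open>
  In this section \<open>W\<close> is an open set of the coordinate space, \<open>g\<close> a hypersurface and \<open>C\<close> a
  transversal field, both given on \<open>W\<close>; tangent vectors are vectors \<open>u\<close> of the coordinate space
  and vector fields are maps on \<open>W\<close> into it.
\<close>

type_synonym 'k para_space = "(real^'k) \<times> (real^'k)"

definition Jt :: "'a \<times> 'a \<Rightarrow> 'a \<times> 'a" where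
  "Jt w = (snd w, fst w)"

abbreviation pushfwd ::
  "('e::euclidean_space \<Rightarrow> 'v::real_normed_vector) \<Rightarrow> 'e \<Rightarrow> 'e \<Rightarrow> 'v" where
  "pushfwd g z \<equiv> frechet_derivative g (at z)"

definition immersion_on ::
  "'e::euclidean_space set \<Rightarrow> ('e \<Rightarrow> 'v::euclidean_space) \<Rightarrow> bool" where
  "immersion_on W g \<longleftrightarrow> smooth_on W g \<and> (\<forall>z\<in>W. inj (pushfwd g z))"

definition transversal_on ::
  "'e::euclidean_space set \<Rightarrow> ('e \<Rightarrow> 'v::euclidean_space) \<Rightarrow> ('e \<Rightarrow> 'v) \<Rightarrow> bool" where
  "transversal_on W g C \<longleftrightarrow> smooth_on W C \<and> (\<forall>z\<in>W. C z \<notin> range (pushfwd g z))"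

definition Jt_tangent_on ::
  "'e::euclidean_space set \<Rightarrow> ('e \<Rightarrow> 'k::finite para_space) \<Rightarrow> ('e \<Rightarrow> 'k para_space) \<Rightarrow> bool" where
  "Jt_tangent_on W g C \<longleftrightarrow> (\<forall>z\<in>W. Jt (C z) \<in> range (pushfwd g z))"

text \<open>The two components of an ambient vector \<open>w = g\<^sub>* u + r C\<close> at the point \<open>z\<close>.\<close>

definition tangential_part ::
  "('e::euclidean_space \<Rightarrow> 'v::euclidean_space) \<Rightarrow> ('e \<Rightarrow> 'v) \<Rightarrow> 'e \<Rightarrow> 'v \<Rightarrow> 'e" where
  "tangential_part g C z w = (THE u. \<exists>r. w = pushfwd g z u + r *\<^sub>R C z)"

definition transversal_part ::
  "('e::euclidean_space \<Rightarrow> 'v::euclidean_space) \<Rightarrow> ('e \<Rightarrow> 'v) \<Rightarrow> 'e \<Rightarrow> 'v \<Rightarrow> real" where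
  "transversal_part g C z w = (THE r. \<exists>u. w = pushfwd g z u + r *\<^sub>R C z)"

text \<open>The flat connection: derivative of the function \<open>F\<close> in the direction of the vector field \<open>X\<close>.\<close>

definition flat_deriv ::
  "('e::euclidean_space \<Rightarrow> 'e) \<Rightarrow> ('e \<Rightarrow> 'v::real_normed_vector) \<Rightarrow> 'e \<Rightarrow> 'v" where
  "flat_deriv X F z = frechet_derivative F (at z) (X z)"

text \<open>Gauss formula: \<open>D\<^sub>X g\<^sub>*Y = g\<^sub>*(\<nabla>\<^sub>X Y) + h(X,Y) C\<close>.\<close>

definition nabla ::
  "('e::euclidean_space \<Rightarrow> 'v::euclidean_space) \<Rightarrow> ('e \<Rightarrow> 'v) \<Rightarrow> ('e \<Rightarrow> 'e) \<Rightarrow> ('e \<Rightarrow> 'e) \<Rightarrow> 'e \<Rightarrow> 'e" where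
  "nabla g C X Y z =
     tangential_part g C z (flat_deriv X (\<lambda>z'. pushfwd g z' (Y z')) z)"

text \<open>Weingarten formula: \<open>D\<^sub>X C = - g\<^sub>*(S X) + \<tau>(X) C\<close>.\<close>

definition transversal_form ::
  "('e::euclidean_space \<Rightarrow> 'v::euclidean_space) \<Rightarrow> ('e \<Rightarrow> 'v) \<Rightarrow> 'e \<Rightarrow> 'e \<Rightarrow> real" where
  "transversal_form g C z u = transversal_part g C z (frechet_derivative C (at z) u)"

definition equiaffine_on ::
  "'e::euclidean_space set \<Rightarrow> ('e \<Rightarrow> 'v::euclidean_space) \<Rightarrow> ('e \<Rightarrow> 'v) \<Rightarrow> bool" where
  "equiaffine_on W g C \<longleftrightarrow> (\<forall>z\<in>W. \<forall>u. transversal_form g C z u = 0)"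

definition distr_D :: "('e::euclidean_space \<Rightarrow> 'k::finite para_space) \<Rightarrow> 'e \<Rightarrow> 'e set" where
  "distr_D g z = pushfwd g z -` (range (pushfwd g z) \<inter> Jt ` range (pushfwd g z))"

definition xi_field ::
  "('e::euclidean_space \<Rightarrow> 'k::finite para_space) \<Rightarrow> ('e \<Rightarrow> 'k para_space) \<Rightarrow> 'e \<Rightarrow> 'e" where
  "xi_field g C z = (THE u. pushfwd g z u = Jt (C z))"

definition eta_form ::
  "('e::euclidean_space \<Rightarrow> 'k::finite para_space) \<Rightarrow> ('e \<Rightarrow> 'k para_space) \<Rightarrow> 'e \<Rightarrow> 'e \<Rightarrow> real" where
  "eta_form g C z = (THE l. linear l \<and> (\<forall>u\<in>distr_D g z. l u = 0) \<and> l (xi_field g C z) = 1)"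

definition phi_tensor ::
  "('e::euclidean_space \<Rightarrow> 'k::finite para_space) \<Rightarrow> ('e \<Rightarrow> 'k para_space) \<Rightarrow> 'e \<Rightarrow> 'e \<Rightarrow> 'e" where
  "phi_tensor g C z = (THE L. linear L \<and>
     (\<forall>u\<in>distr_D g z. pushfwd g z (L u) = Jt (pushfwd g z u)) \<and> L (xi_field g C z) = 0)"

text \<open>
  The covariant derivatives are \<open>(\<nabla>\<^sub>X \<phi>) Y = \<nabla>\<^sub>X(\<phi> Y) - \<phi>(\<nabla>\<^sub>X Y)\<close> and
  \<open>(\<nabla>\<^sub>X \<eta>) Y = X(\<eta> Y) - \<eta>(\<nabla>\<^sub>X Y)\<close>.
\<close>

definition phi_parallel_on ::
  "'e::euclidean_space set \<Rightarrow> ('e \<Rightarrow> 'k::finite para_space) \<Rightarrow> ('e \<Rightarrow> 'k para_space) \<Rightarrow> bool" where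
  "phi_parallel_on W g C \<longleftrightarrow> (\<forall>X Y. smooth_on W X \<longrightarrow> smooth_on W Y \<longrightarrow>
     (\<forall>z\<in>W. nabla g C X (\<lambda>z'. phi_tensor g C z' (Y z')) z
             - phi_tensor g C z (nabla g C X Y z) = 0))"

definition eta_parallel_on ::
  "'e::euclidean_space set \<Rightarrow> ('e \<Rightarrow> 'k::finite para_space) \<Rightarrow> ('e \<Rightarrow> 'k para_space) \<Rightarrow> bool" where
  "eta_parallel_on W g C \<longleftrightarrow> (\<forall>X Y. smooth_on W X \<longrightarrow> smooth_on W Y \<longrightarrow>
     (\<forall>z\<in>W. flat_deriv X (\<lambda>z'. eta_form g C z' (Y z')) z
             - eta_form g C z (nabla g C X Y z) = 0))"

definition xi_parallel_on ::
  "'e::euclidean_space set \<Rightarrow> ('e \<Rightarrow> 'k::finite para_space) \<Rightarrow> ('e \<Rightarrow> 'k para_space) \<Rightarrow> bool" where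
  "xi_parallel_on W g C \<longleftrightarrow> (\<forall>X. smooth_on W X \<longrightarrow>
     (\<forall>z\<in>W. nabla g C X (xi_field g C) z = 0))"

section \<open>Hypersurfaces on manifolds\<close>

text \<open>
  All conditions above are invariant under changes of coordinates and local, so a condition on a
  map \<open>f\<close> (or a pair \<open>f\<close>, \<open>C\<close>) on the manifold means the condition on its coordinate expression
  in every chart.
\<close>

definition affine_hypersurface ::
  "'m::{t2_space, second_countable_topology} set \<Rightarrow> ('m, real^'d) chart set
    \<Rightarrow> ('m \<Rightarrow> 'v::euclidean_space) \<Rightarrow> bool" where
  "affine_hypersurface M A f \<longleftrightarrow> smooth_atlas M A \<and> connected M \<and> orientable M A \<and>
     DIM('v) = CARD('d) + 1 \<and>
     (\<forall>c\<in>A. immersion_on (chart_image c) (f \<circ> chart_inv c))"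

definition in_charts ::
  "('m, 'e) chart set \<Rightarrow> ('e set \<Rightarrow> ('e \<Rightarrow> 'v) \<Rightarrow> ('e \<Rightarrow> 'v) \<Rightarrow> bool)
    \<Rightarrow> ('m \<Rightarrow> 'v) \<Rightarrow> ('m \<Rightarrow> 'v) \<Rightarrow> bool" where
  "in_charts A P f C \<longleftrightarrow> (\<forall>c\<in>A. P (chart_image c) (f \<circ> chart_inv c) (C \<circ> chart_inv c))"

section \<open>The normal form\<close>

definition admissible_vectors ::
  "nat \<Rightarrow> (nat \<Rightarrow> 'k::finite para_space) \<Rightarrow> 'k para_space \<Rightarrow> bool" where
  "admissible_vectors n b v \<longleftrightarrow>
     (let vs = map b [1..<2*n+1] @ [v, Jt v] in distinct vs \<and> independent (set vs)) \<and>
     (\<forall>i\<in>{1..n}. Jt (b i) = b i) \<and> (\<forall>i\<in>{n+1..2*n}. Jt (b i) = - b i)"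

text \<open>\<open>P\<close> and \<open>Q\<close> are antiderivatives of \<open>cosh \<alpha>\<close> and \<open>sinh \<alpha>\<close>, with \<open>\<alpha>\<close> smooth on the open
  interval \<open>I\<close>.\<close>

definition profile ::
  "real set \<Rightarrow> (real \<Rightarrow> real) \<Rightarrow> (real \<Rightarrow> real) \<Rightarrow> (real \<Rightarrow> real) \<Rightarrow> bool" where
  "profile I \<alpha> P Q \<longleftrightarrow> open I \<and> is_interval I \<and> smooth_on I \<alpha> \<and>
     (\<forall>t\<in>I. (P has_real_derivative cosh (\<alpha> t)) (at t)) \<and>
     (\<forall>t\<in>I. (Q has_real_derivative sinh (\<alpha> t)) (at t))"

text \<open>\<open>e\<close> enumerates the coordinates of \<open>real^'d\<close> as \<open>x\<^sub>1, \<dots>, x\<^sub>2\<^sub>n, y\<close>, with \<open>y\<close> at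
  position \<open>2 * n + 1\<close>.\<close>

definition normal_form ::
  "nat \<Rightarrow> (nat \<Rightarrow> 'd::finite) \<Rightarrow> (nat \<Rightarrow> 'k::finite para_space) \<Rightarrow> 'k para_space
    \<Rightarrow> (real \<Rightarrow> real) \<Rightarrow> (real \<Rightarrow> real) \<Rightarrow> real^'d \<Rightarrow> 'k para_space" where
  "normal_form n e b v P Q z = (\<Sum>i=1..2*n. (z $ e i) *\<^sub>R b i)
     + P (z $ e (2*n+1)) *\<^sub>R Jt v + Q (z $ e (2*n+1)) *\<^sub>R v"

end

theory Submission
  imports Defs
begin

text \<open>
  Write \<open>N\<close> for the conormal field of \<open>f\<close> with \<open>N(C) = 1\<close>. Then \<open>\<eta>(Y) = N(J f\<^sub>* Y)\<close>, and either
  parallelity hypothesis says that \<open>h(X, Y) = 0\<close> for all \<open>X\<close> and all \<open>Y\<close> in \<open>\<D>\<close>, that is, the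
  derivative of \<open>N\<close> vanishes on \<open>f\<^sub>* \<D>\<close> and hence is a combination of \<open>N\<close> and \<open>N \<circ> J\<close>. Consequently
  the derivatives of \<open>N + N \<circ> J\<close> and of \<open>N - N \<circ> J\<close> are multiples of these forms themselves, which
  therefore have constant directions, \<open>a\<close> and \<open>a'\<close> say. The hyperplanes \<open>a = 0\<close> and \<open>a' = 0\<close> of the two eigenspaces of
  \<open>J\<close> provide the vectors \<open>b\<^sub>i\<close>, the functions \<open>s = a \<circ> f\<close> and \<open>t = a' \<circ> f\<close> satisfy \<open>dt = - \<rho> ds\<close> with
  \<open>\<rho> > 0\<close>, and \<open>y\<close> is the primitive of \<open>\<surd>\<rho> ds\<close>: with respect to it \<open>s' = 1 / \<surd>\<rho> = exp \<alpha>\<close> and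
  \<open>t' = - exp (- \<alpha>)\<close>. Conversely, for \<open>f\<close> in normal form the field \<open>C = J (\<partial>f / \<partial>y)\<close> induces the
  standard flat connection of the coordinate space, and \<open>\<phi>\<close>, \<open>\<xi>\<close>, \<open>\<eta>\<close> have constant coefficients.
\<close>

subsection \<open>Calculus of smooth maps\<close>

abbreviation "hd_on \<equiv> higher_differentiable_on"

lemma frechet_derivative_eq: "(f has_derivative f') (at x) \<Longrightarrow> frechet_derivative f (at x) = f'"
  using frechet_derivative_at by metis

lemma hd_on_cong:
  assumes "open S" "\<And>x. x \<in> S \<Longrightarrow> f x = g x"
  shows "hd_on k S f \<longleftrightarrow> hd_on k S g"
  using assms(2)
proof (induction k arbitrary: f g)
  case 0
  then show ?case by (auto intro: continuous_on_cong)
next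
  case (Suc k)
  have d: "(f has_derivative f') (at x) \<longleftrightarrow> (g has_derivative f') (at x)" if "x \<in> S" for x f'
    using has_derivative_transform_within_open[OF _ assms(1) that, of f f' UNIV g]
      has_derivative_transform_within_open[OF _ assms(1) that, of g f' UNIV f] Suc.prems
    by auto
  then have "f differentiable (at x) \<longleftrightarrow> g differentiable (at x)" if "x \<in> S" for x
    using that by (auto simp: differentiable_def)
  moreover have "frechet_derivative f (at x) = frechet_derivative g (at x)" if "x \<in> S" for x
    using d[OF that] by (auto simp: frechet_derivative_def)
  ultimately show ?case
    using Suc.IH[of "\<lambda>x. frechet_derivative f (at x) v" "\<lambda>x. frechet_derivative g (at x) v" for v]
    by auto
qed

text \<open>Since \<open>S\<close> is open, any formula for the derivative that is valid on
  \<open>S\<close> may replace \<open>frechet_derivative\<close>. The closure properties below rest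
  on this.\<close>

lemma hd_on_SucI:
  assumes "open S" "\<And>x. x \<in> S \<Longrightarrow> (f has_derivative f' x) (at x)" "\<And>v. hd_on k S (\<lambda>x. f' x v)"
  shows "hd_on (Suc k) S f"
proof -
  have "hd_on k S (\<lambda>x. frechet_derivative f (at x) v)" for v
    using assms(3)[of v] hd_on_cong[OF assms(1), of "\<lambda>x. frechet_derivative f (at x) v" "\<lambda>x. f' x v"]
      frechet_derivative_eq[OF assms(2)] by auto
  then show ?thesis
    using assms(2) by (auto simp: differentiable_def)
qed

lemma hd_on_has_derivative:
  "hd_on (Suc k) S f \<Longrightarrow> x \<in> S \<Longrightarrow> (f has_derivative frechet_derivative f (at x)) (at x)"
  by (simp add: frechet_derivative_works)

lemma hd_on_SucD: "hd_on (Suc k) S f \<Longrightarrow> hd_on k S f"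
proof (induction k arbitrary: f)
  case 0
  then show ?case
    by (auto intro!: differentiable_imp_continuous_on simp: differentiable_on_def differentiable_at_withinI)
next
  case (Suc k)
  then show ?case by (metis higher_differentiable_on.simps(2))
qed

lemma hd_on_subset: "hd_on k S f \<Longrightarrow> T \<subseteq> S \<Longrightarrow> hd_on k T f"
  by (induction k arbitrary: f) (auto intro: continuous_on_subset)

lemma hd_on_continuous: "hd_on k S f \<Longrightarrow> continuous_on S f"
  by (induction k) (use hd_on_SucD in auto)

lemma hd_on_const: "hd_on k S (\<lambda>x. c)"
  by (induction k arbitrary: c) auto

lemma hd_on_bounded_linear:
  assumes "open S" "bounded_linear L" "hd_on k S f"
  shows "hd_on k S (\<lambda>x. L (f x))"
  using assms(3)
proof (induction k arbitrary: f)
  case 0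
  then show ?case
    using assms(2) by (auto intro: bounded_linear.continuous_on)
next
  case (Suc k)
  show ?case
    by (rule hd_on_SucI[OF assms(1) bounded_linear.has_derivative[OF assms(2) hd_on_has_derivative[OF Suc.prems]]])
      (use Suc in auto)
qed

lemma hd_on_ident: "open S \<Longrightarrow> hd_on k S (\<lambda>x. x)"
proof (cases k)
  case (Suc j)
  assume "open S"
  then show ?thesis unfolding Suc
    by (rule hd_on_SucI[OF _ has_derivative_ident]) (rule hd_on_const)
qed simp

lemma hd_on_linear_map: "open S \<Longrightarrow> bounded_linear L \<Longrightarrow> hd_on k S L"
  using hd_on_bounded_linear[OF _ _ hd_on_ident] by blast

lemma hd_on_add:
  assumes "open S" "hd_on k S f" "hd_on k S g"
  shows "hd_on k S (\<lambda>x. f x + g x)"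
  using assms(2,3)
proof (induction k arbitrary: f g)
  case 0
  then show ?case by (auto intro: continuous_intros)
next
  case (Suc k)
  show ?case
    by (rule hd_on_SucI[OF assms(1) has_derivative_add[OF hd_on_has_derivative[OF Suc.prems(1)]
            hd_on_has_derivative[OF Suc.prems(2)]]])
      (use Suc in auto)
qed

text \<open>The Leibniz rule yields two terms of the same bilinear shape, each pairing a derivative
  with an undifferentiated factor. The induction hypothesis covers both once the undifferentiated
  factors are lowered from order \<open>Suc k\<close> to \<open>k\<close>.\<close>

lemma hd_on_bilinear:
  assumes "open S" "bounded_bilinear B" "hd_on k S f" "hd_on k S g"
  shows "hd_on k S (\<lambda>x. B (f x) (g x))"
  using assms(3,4)
proof (induction k arbitrary: f g)
  case 0
  then show ?case
    using assms(2) by (auto intro: bounded_bilinear.continuous_on)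
next
  case (Suc k)
  show ?case
    by (rule hd_on_SucI[OF assms(1) bounded_bilinear.FDERIV[OF assms(2) hd_on_has_derivative[OF Suc.prems(1)]
            hd_on_has_derivative[OF Suc.prems(2)]]], assumption, assumption)
      (rule hd_on_add[OF assms(1)]; rule Suc.IH; use Suc.prems Suc.prems[THEN hd_on_SucD] in simp)
qed

lemmas hd_on_mult = hd_on_bilinear[OF _ bounded_bilinear_mult]
lemmas hd_on_scaleR = hd_on_bilinear[OF _ bounded_bilinear_scaleR]
lemmas hd_on_inner = hd_on_bilinear[OF _ bounded_bilinear_inner]

lemma hd_on_minus: "open S \<Longrightarrow> hd_on k S f \<Longrightarrow> hd_on k S (\<lambda>x. - f x)"
  by (rule hd_on_bounded_linear) (auto intro: bounded_linear_minus bounded_linear_ident)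

lemma hd_on_diff: "open S \<Longrightarrow> hd_on k S f \<Longrightarrow> hd_on k S g \<Longrightarrow> hd_on k S (\<lambda>x. f x - g x)"
  using hd_on_add[of S k f "\<lambda>x. - g x"] hd_on_minus by auto

lemma hd_on_sum:
  "open S \<Longrightarrow> (\<And>i. i \<in> I \<Longrightarrow> hd_on k S (f i)) \<Longrightarrow> hd_on k S (\<lambda>x. \<Sum>i\<in>I. f i x)"
  by (induction I rule: infinite_finite_induct) (simp_all add: hd_on_const hd_on_add)

lemma hd_on_prod:
  fixes f :: "'i \<Rightarrow> 'a::real_normed_vector \<Rightarrow> real"
  shows "open S \<Longrightarrow> (\<And>i. i \<in> I \<Longrightarrow> hd_on k S (f i)) \<Longrightarrow> hd_on k S (\<lambda>x. \<Prod>i\<in>I. f i x)"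
  by (induction I rule: infinite_finite_induct) (simp_all add: hd_on_const hd_on_mult)

lemma hd_on_vec:
  fixes f :: "'a::real_normed_vector \<Rightarrow> real^'n"
  assumes "open S" "\<And>i. hd_on k S (\<lambda>x. f x $ i)"
  shows "hd_on k S f"
proof -
  have "f = (\<lambda>x. \<Sum>i\<in>UNIV. (f x $ i) *\<^sub>R axis i 1)"
    by (auto simp: fun_eq_iff vec_eq_iff axis_def if_distrib cong: if_cong)
  moreover have "hd_on k S (\<lambda>x. \<Sum>i\<in>UNIV. (f x $ i) *\<^sub>R (axis i 1 :: real^'n))"
    using assms by (intro hd_on_sum hd_on_scaleR hd_on_const)
  ultimately show ?thesis by metis
qed

text \<open>\<open>higher_differentiable_on\<close> speaks of derivatives in constant directions
  only; expanding \<open>Y z\<close> in \<open>Basis\<close> reduces a varying direction to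
  these.\<close>

lemma hd_on_frechet_apply:
  fixes g :: "'e::euclidean_space \<Rightarrow> 'v::real_normed_vector"
  assumes "open S" "hd_on (Suc k) S g" "hd_on k S Y"
  shows "hd_on k S (\<lambda>z. frechet_derivative g (at z) (Y z))"
proof -
  have "frechet_derivative g (at z) (Y z) = (\<Sum>b\<in>Basis. (Y z \<bullet> b) *\<^sub>R frechet_derivative g (at z) b)"
    if "z \<in> S" for z
  proof -
    interpret linear "frechet_derivative g (at z)"
      using assms(2) that by (simp add: linear_frechet_derivative)
    show ?thesis
      by (subst euclidean_representation[of "Y z", symmetric]) (simp add: sum scaleR)
  qed
  moreover have "hd_on k S (\<lambda>z. \<Sum>b\<in>Basis. (Y z \<bullet> b) *\<^sub>R frechet_derivative g (at z) b)"
    using assms by (intro hd_on_sum hd_on_scaleR hd_on_inner hd_on_const) auto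
  ultimately show ?thesis
    using hd_on_cong[OF assms(1)] by (metis (no_types, lifting))
qed

text \<open>The chain rule evaluates the derivative of \<open>f\<close> at \<open>g x\<close> in a
  direction that varies with \<open>x\<close>. Expanding this direction in a basis of the middle
  space leaves sums of products, and the induction hypothesis applies to each directional derivative
  of \<open>f\<close>.\<close>

lemma hd_on_compose:
  fixes g :: "'a::real_normed_vector \<Rightarrow> 'b::euclidean_space" and f :: "'b \<Rightarrow> 'c::real_normed_vector"
  assumes "open S" "open T" "g ` S \<subseteq> T" "hd_on k S g" "hd_on k T f"
  shows "hd_on k S (\<lambda>x. f (g x))"
  using assms(4,5)
proof (induction k arbitrary: f)
  case 0
  then show ?case
    using continuous_on_compose2[OF _ _ assms(3), of f] by simp
next
  case (Suc k)
  have *: "((\<lambda>x. f (g x)) has_derivative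
      (\<lambda>v. \<Sum>b\<in>Basis. (frechet_derivative g (at x) v \<bullet> b) *\<^sub>R frechet_derivative f (at (g x)) b)) (at x)"
    if "x \<in> S" for x
  proof -
    have gx: "g x \<in> T"
      using that assms(3) by auto
    interpret linear "frechet_derivative f (at (g x))"
      using Suc.prems(2) gx by (simp add: linear_frechet_derivative)
    have eq: "(\<lambda>v. \<Sum>b\<in>Basis. (frechet_derivative g (at x) v \<bullet> b) *\<^sub>R frechet_derivative f (at (g x)) b)
        = (\<lambda>v. frechet_derivative f (at (g x)) (frechet_derivative g (at x) v))"
      by (rule ext) (simp flip: sum scaleR add: euclidean_representation)
    show ?thesis
      unfolding eq
      by (rule has_derivative_compose[OF hd_on_has_derivative[OF Suc.prems(1) that] hd_on_has_derivative[OF Suc.prems(2) gx]])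
  qed
  show ?case
  proof (rule hd_on_SucI[OF assms(1) *])
    fix v
    have f: "hd_on k S (\<lambda>x. frechet_derivative f (at (g x)) b)" for b
      by (rule Suc.IH[OF hd_on_SucD[OF Suc.prems(1)]]) (use Suc.prems(2) in simp)
    have g: "hd_on k S (\<lambda>x. frechet_derivative g (at x) v)"
      using Suc.prems(1) by simp
    show "hd_on k S (\<lambda>x. \<Sum>b\<in>Basis. (frechet_derivative g (at x) v \<bullet> b) *\<^sub>R frechet_derivative f (at (g x)) b)"
      by (intro hd_on_sum hd_on_scaleR hd_on_inner hd_on_const assms(1) f g)
  qed
qed

section \<open>Smoothness of elementary functions\<close>

lemma hd_on_inverse: "hd_on k {x::real. x \<noteq> 0} inverse"
proof (induction k)
  case 0
  then show ?case by (auto intro: continuous_intros)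
next
  case (Suc k)
  have o: "open {x::real. x \<noteq> 0}"
    by (simp add: open_Collect_neq)
  have d: "(inverse has_derivative (\<lambda>h. - (inverse x * h * inverse x))) (at x)" if "x \<noteq> 0" for x :: real
    using that by (rule has_derivative_inverse')
  show ?case
    by (rule hd_on_SucI[OF o d]) (use o Suc in \<open>simp_all add: hd_on_minus hd_on_mult hd_on_const\<close>)
qed

lemma hd_on_divide:
  fixes f g :: "'a::real_normed_vector \<Rightarrow> real"
  assumes "open S" "hd_on k S f" "hd_on k S g" "\<And>x. x \<in> S \<Longrightarrow> g x \<noteq> 0"
  shows "hd_on k S (\<lambda>x. f x / g x)"
  unfolding divide_inverse
  by (intro hd_on_mult hd_on_compose[OF _ _ _ _ hd_on_inverse] assms)
    (use assms in \<open>auto simp: open_Collect_neq\<close>)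

lemma hd_on_exp: "hd_on k UNIV (exp :: real \<Rightarrow> real)"
proof (induction k)
  case 0
  then show ?case by (auto intro: continuous_intros)
next
  case (Suc k)
  have d: "(exp has_derivative (\<lambda>h. exp x * h)) (at x)" for x :: real
    using DERIV_exp[of x] by (simp add: has_field_derivative_def)
  show ?case
    by (rule hd_on_SucI[OF open_UNIV d]) (use Suc in \<open>simp_all add: hd_on_mult hd_on_const\<close>)
qed

lemma hd_on_ln: "hd_on k {0<..} (ln :: real \<Rightarrow> real)"
proof (cases k)
  case 0
  then show ?thesis by (auto intro: continuous_intros)
next
  case (Suc j)
  have d: "(ln has_derivative (\<lambda>h. inverse x * h)) (at x)" if "x > 0" for x :: real
    using DERIV_ln[OF that] by (simp add: has_field_derivative_def)
  have "hd_on j {0<..} (inverse :: real \<Rightarrow> real)" for j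
    by (rule hd_on_subset[OF hd_on_inverse]) auto
  then show ?thesis unfolding Suc
    by (intro hd_on_SucI[OF open_greaterThan d]) (simp_all add: hd_on_mult hd_on_const)
qed

lemma hd_on_exp_compose:
  fixes f :: "'a::real_normed_vector \<Rightarrow> real"
  assumes "open S" "hd_on k S f"
  shows "hd_on k S (\<lambda>x. exp (f x))"
  using hd_on_compose[OF assms(1) open_UNIV _ assms(2) hd_on_exp] by simp

lemma hd_on_ln_compose:
  fixes f :: "'a::real_normed_vector \<Rightarrow> real"
  assumes "open S" "hd_on k S f" "\<And>x. x \<in> S \<Longrightarrow> f x > 0"
  shows "hd_on k S (\<lambda>x. ln (f x))"
  using hd_on_compose[OF assms(1) open_greaterThan _ assms(2) hd_on_ln] assms(3) by auto

lemma hd_on_sqrt_compose: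
  fixes f :: "'a::real_normed_vector \<Rightarrow> real"
  assumes "open S" "hd_on k S f" "\<And>x. x \<in> S \<Longrightarrow> f x > 0"
  shows "hd_on k S (\<lambda>x. sqrt (f x))"
proof -
  have "sqrt (f x) = exp (ln (f x) / 2)" if "x \<in> S" for x
    using assms(3)[OF that] by (simp add: ln_sqrt[symmetric])
  moreover have "hd_on k S (\<lambda>x. exp (ln (f x) / 2))"
    by (intro hd_on_exp_compose hd_on_divide hd_on_ln_compose hd_on_const assms) auto
  ultimately show ?thesis
    using hd_on_cong[OF assms(1), of "\<lambda>x. sqrt (f x)" "\<lambda>x. exp (ln (f x) / 2)"] by simp
qed

lemma hd_on_cosh_sinh:
  fixes f :: "'a::real_normed_vector \<Rightarrow> real"
  assumes "open S" "hd_on k S f"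
  shows "hd_on k S (\<lambda>x. cosh (f x))" "hd_on k S (\<lambda>x. sinh (f x))"
  unfolding cosh_field_def sinh_field_def
  by (intro hd_on_divide hd_on_add hd_on_diff hd_on_exp_compose hd_on_minus hd_on_const assms; simp)+

lemma hd_on_det:
  fixes A :: "'a::real_normed_vector \<Rightarrow> real^'n^'n"
  assumes "open S" "\<And>i j. hd_on k S (\<lambda>x. A x $ i $ j)"
  shows "hd_on k S (\<lambda>x. det (A x))"
  unfolding det_def using assms by (intro hd_on_sum hd_on_mult hd_on_const hd_on_prod)

section \<open>Left inverses of injective linear maps\<close>

text \<open>The least squares solution of \<open>A u = w\<close>, written by Cramer's rule so that it depends
  smoothly on \<open>A\<close> and \<open>w\<close>.\<close>

definition gram :: "(real^'d \<Rightarrow> 'v::euclidean_space) \<Rightarrow> real^'d^'d" where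
  "gram A = (\<chi> i j. A (axis i 1) \<bullet> A (axis j 1))"

definition left_inv :: "(real^'d \<Rightarrow> 'v::euclidean_space) \<Rightarrow> 'v \<Rightarrow> real^'d" where
  "left_inv A w = (\<chi> k. det (\<chi> i j. if j = k then A (axis i 1) \<bullet> w else gram A $ i $ j) / det (gram A))"

lemma linear_sum_axis:
  fixes A :: "real^'d \<Rightarrow> 'v::real_vector"
  assumes "linear A"
  shows "A u = (\<Sum>j\<in>UNIV. (u $ j) *\<^sub>R A (axis j 1))"
proof -
  have "u = (\<Sum>j\<in>UNIV. (u $ j) *\<^sub>R axis j 1)"
    by (auto simp: vec_eq_iff axis_def if_distrib cong: if_cong)
  then have "A u = A (\<Sum>j\<in>UNIV. (u $ j) *\<^sub>R axis j 1)" by metis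
  also have "\<dots> = (\<Sum>j\<in>UNIV. (u $ j) *\<^sub>R A (axis j 1))"
    by (simp add: linear_sum[OF assms] linear_scale[OF assms])
  finally show ?thesis .
qed

lemma gram_mult:
  assumes "linear A"
  shows "(gram A *v u) $ i = A (axis i 1) \<bullet> A u"
  unfolding gram_def matrix_vector_mult_def
  by (subst (2) linear_sum_axis[OF assms]) (simp add: inner_sum_right mult.commute)

text \<open>A kernel vector \<open>u\<close> of the Gram matrix satisfies
  \<open>A u \<bullet> A u = 0\<close>, which injectivity forbids for nonzero
  \<open>u\<close>.\<close>

lemma det_gram_nonzero:
  assumes "linear A" "inj A"
  shows "det (gram A) \<noteq> 0"
proof
  assume "det (gram A) = 0"
  then obtain u where u: "u \<noteq> 0" "gram A *v u = 0"
    using matrix_left_invertible_ker[of "gram A"] invertible_det_nz[of "gram A"] invertible_left_inverse[of "gram A"]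
    by blast
  have "A u \<bullet> A u = (\<Sum>i\<in>UNIV. (u $ i) * (A (axis i 1) \<bullet> A u))"
    by (subst (1) linear_sum_axis[OF assms(1)]) (simp add: inner_sum_left)
  also have "\<dots> = 0"
    using u(2) by (simp flip: gram_mult[OF assms(1)])
  finally have "A u = 0" by simp
  with u(1) show False
    using assms linear_injective_0 by blast
qed

text \<open>Cramer's rule solves the normal equations, so \<open>A (left_inv A w)\<close> is the
  orthogonal projection of \<open>w\<close> to the range of \<open>A\<close>, also when
  \<open>w\<close> lies outside that range.\<close>

lemma left_inv_normal_eq:
  assumes "linear A" "inj A"
  shows "A x \<bullet> A (left_inv A w) = A x \<bullet> w"
proof -
  have "gram A *v left_inv A w = (\<chi> i. A (axis i 1) \<bullet> w)"
    by (subst cramer[OF det_gram_nonzero[OF assms]]) (simp add: left_inv_def cong: if_cong)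
  then have "A (axis i 1) \<bullet> A (left_inv A w) = A (axis i 1) \<bullet> w" for i
    by (simp flip: gram_mult[OF assms(1)])
  then show ?thesis
    by (subst (1 3) linear_sum_axis[OF assms(1)]) (simp add: inner_sum_left)
qed

lemma left_inv_apply:
  assumes "linear A" "inj A"
  shows "left_inv A (A u) = u"
proof -
  have "A x \<bullet> A (left_inv A (A u) - u) = 0" for x
    using left_inv_normal_eq[OF assms, of x "A u"] by (simp add: linear_diff[OF assms(1)] inner_diff_right)
  then have "A (left_inv A (A u) - u) = 0"
    using inner_eq_zero_iff by blast
  then show ?thesis
    using assms linear_injective_0 by fastforce
qed

lemma hd_on_left_inv:
  fixes A :: "'a::real_normed_vector \<Rightarrow> real^'d \<Rightarrow> 'v::euclidean_space"
  assumes "open S" "\<And>i. hd_on k S (\<lambda>z. A z (axis i 1))" "hd_on k S w"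
    "\<And>z. z \<in> S \<Longrightarrow> linear (A z)" "\<And>z. z \<in> S \<Longrightarrow> inj (A z)"
  shows "hd_on k S (\<lambda>z. left_inv (A z) (w z))"
proof -
  have g: "hd_on k S (\<lambda>z. gram (A z) $ i $ j)" for i j
    using assms by (auto simp: gram_def intro: hd_on_inner)
  show ?thesis
  proof (rule hd_on_vec[OF assms(1)])
    fix l
    have "hd_on k S (\<lambda>z. det (\<chi> i j. if j = l then A z (axis i 1) \<bullet> w z else gram (A z) $ i $ j) / det (gram (A z)))"
    proof (intro hd_on_divide hd_on_det assms(1) g)
      show "hd_on k S (\<lambda>z. (\<chi> i j. if j = l then A z (axis i 1) \<bullet> w z else gram (A z) $ i $ j) $ i $ j)" for i j
        using hd_on_inner[OF assms(1,2,3)] g[of i j] by (cases "j = l") simp_all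
      show "det (gram (A z)) \<noteq> 0" if "z \<in> S" for z
        using det_gram_nonzero assms(4,5) that by blast
    qed
    then show "hd_on k S (\<lambda>z. left_inv (A z) (w z) $ l)"
      by (simp add: left_inv_def)
  qed
qed

section \<open>Smooth local inverses and functions of one coordinate\<close>

lemma smooth_onD: "smooth_on S f \<Longrightarrow> hd_on k S f"
  by (simp add: smooth_on_def)

lemma smooth_onI: "(\<And>k. hd_on k S f) \<Longrightarrow> smooth_on S f"
  by (simp add: smooth_on_def)

lemma smooth_on_subset: "smooth_on S f \<Longrightarrow> T \<subseteq> S \<Longrightarrow> smooth_on T f"
  by (auto simp: smooth_on_def intro: hd_on_subset)

lemma smooth_on_cong:
  "open S \<Longrightarrow> (\<And>x. x \<in> S \<Longrightarrow> f x = g x) \<Longrightarrow> smooth_on S f \<longleftrightarrow> smooth_on S g"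
  unfolding smooth_on_def using hd_on_cong by blast

lemma smooth_on_has_derivative:
  "smooth_on S f \<Longrightarrow> x \<in> S \<Longrightarrow> (f has_derivative frechet_derivative f (at x)) (at x)"
  using smooth_onD hd_on_has_derivative by blast

lemma smooth_on_linear_frechet: "smooth_on S f \<Longrightarrow> x \<in> S \<Longrightarrow> linear (frechet_derivative f (at x))"
  using smooth_on_has_derivative has_derivative_linear by blast

lemma smooth_on_compose:
  fixes g :: "'a::real_normed_vector \<Rightarrow> 'b::euclidean_space" and f :: "'b \<Rightarrow> 'c::real_normed_vector"
  assumes "open S" "open T" "g ` S \<subseteq> T" "smooth_on S g" "smooth_on T f"
  shows "smooth_on S (\<lambda>x. f (g x))"
  by (rule smooth_onI, rule hd_on_compose[OF assms(1-3)]) (use assms(4,5) smooth_onD in blast)+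

text \<open>The inverse function theorem gives a differentiable inverse, whose smoothness follows by
  bootstrapping. The image is cut down to a ball because later arguments move along segments in
  it.\<close>

lemma smooth_local_inverse:
  fixes \<psi> :: "real^'d \<Rightarrow> real^'d"
  assumes W: "open W" "z0 \<in> W" and sm: "smooth_on W \<psi>" and inj: "inj (frechet_derivative \<psi> (at z0))"
  obtains U \<Phi> \<delta> where "open U" "z0 \<in> U" "U \<subseteq> W" "\<delta> > 0"
    "homeomorphism U (ball (\<psi> z0) \<delta>) \<psi> \<Phi>" "smooth_on (ball (\<psi> z0) \<delta>) \<Phi>"
    "\<And>z. z \<in> U \<Longrightarrow> bij (frechet_derivative \<psi> (at z))"
proof -
  define \<psi>' where "\<psi>' z = Blinfun (frechet_derivative \<psi> (at z))" for z
  have ap: "blinfun_apply (\<psi>' z) = frechet_derivative \<psi> (at z)" if "z \<in> W" for z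
    using smooth_on_has_derivative[OF sm that]
    by (simp add: \<psi>'_def bounded_linear_Blinfun_apply has_derivative_bounded_linear)
  have der: "(\<psi> has_derivative blinfun_apply (\<psi>' z)) (at z)" if "z \<in> W" for z
    using smooth_on_has_derivative[OF sm that] ap[OF that] by simp
  have cont: "continuous_on W \<psi>'"
  proof (rule continuous_on_blinfun_componentwise)
    fix i :: "real^'d"
    have "continuous_on W (\<lambda>z. frechet_derivative \<psi> (at z) i)"
      using smooth_onD[OF sm, of 1] by simp
    then show "continuous_on W (\<lambda>z. blinfun_apply (\<psi>' z) i)"
      using ap by (simp cong: continuous_on_cong)
  qed
  obtain G where G: "linear G" "G \<circ> frechet_derivative \<psi> (at z0) = id"
    using linear_injective_left_inverse[OF smooth_on_linear_frechet[OF sm W(2)] inj] by blast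
  have "Blinfun G o\<^sub>L \<psi>' z0 = id_blinfun"
    using G ap[OF W(2)]
    by (intro blinfun_eqI) (simp add: bounded_linear_Blinfun_apply linear_linear fun_eq_iff)
  then obtain U' V \<Phi> \<Phi>' where U': "open U'" "U' \<subseteq> W" "z0 \<in> U'" and V: "open V" "\<psi> z0 \<in> V"
    and hom: "homeomorphism U' V \<psi> \<Phi>"
    and d\<Phi>: "\<And>y. y \<in> V \<Longrightarrow> (\<Phi> has_derivative (\<Phi>' y)) (at y)"
      "\<And>y. y \<in> V \<Longrightarrow> \<Phi>' y = inv (blinfun_apply (\<psi>' (\<Phi> y)))"
      "\<And>y. y \<in> V \<Longrightarrow> bij (blinfun_apply (\<psi>' (\<Phi> y)))"
    using inverse_function_theorem[OF W(1) der cont W(2)] by metis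
  obtain \<delta> where \<delta>: "\<delta> > 0" "ball (\<psi> z0) \<delta> \<subseteq> V"
    using V openE by blast
  have \<Phi>W: "\<Phi> y \<in> U'" "\<psi> (\<Phi> y) = y" if "y \<in> V" for y
    using hom that by (auto simp: homeomorphism_def)
  have inj\<Phi>: "linear (frechet_derivative \<psi> (at (\<Phi> y)))" "bij (frechet_derivative \<psi> (at (\<Phi> y)))" if "y \<in> V" for y
    using \<Phi>W(1)[OF that] d\<Phi>(3)[OF that] ap U'(2) smooth_on_linear_frechet[OF sm] by auto
  have d\<Phi>': "\<Phi>' y v = left_inv (frechet_derivative \<psi> (at (\<Phi> y))) v" if "y \<in> V" for y v
  proof -
    have "\<Phi>' y v = inv (frechet_derivative \<psi> (at (\<Phi> y))) v"
      using d\<Phi>(2)[OF that] ap \<Phi>W(1)[OF that] U'(2) by (metis subsetD)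
    also have "\<dots> = left_inv (frechet_derivative \<psi> (at (\<Phi> y))) v"
      using left_inv_apply[OF inj\<Phi>(1)[OF that] bij_is_inj[OF inj\<Phi>(2)[OF that]]] inj\<Phi>(2)[OF that]
      by (metis bij_inv_eq_iff)
    finally show ?thesis .
  qed
  \<comment> \<open>The derivative of \<Phi> at \<open>y\<close> is \<open>left_inv\<close> of the
    derivative of \<psi> at \<open>\<Phi> y\<close>. Thus order \<open>k\<close> of \<Phi> gives
    order \<open>k\<close> of its derivative, hence order \<open>Suc k\<close> of \<Phi>.\<close>
  have hd: "hd_on k V \<Phi>" for k
  proof (induction k)
    case 0
    then show ?case using hom by (simp add: homeomorphism_def)
  next
    case (Suc k)
    show ?case
    proof (rule hd_on_SucI[OF V(1) d\<Phi>(1)])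
      fix v
      have "hd_on k V (\<lambda>y. left_inv (frechet_derivative \<psi> (at (\<Phi> y))) v)"
      proof (rule hd_on_left_inv[OF V(1) _ hd_on_const])
        show "hd_on k V (\<lambda>y. frechet_derivative \<psi> (at (\<Phi> y)) (axis i 1))" for i
        proof (rule hd_on_compose[OF V(1) W(1) _ Suc.IH, of "\<lambda>z. frechet_derivative \<psi> (at z) (axis i 1)"])
          show "hd_on k W (\<lambda>z. frechet_derivative \<psi> (at z) (axis i 1))"
            using smooth_onD[OF sm, of "Suc k"] by simp
        qed (use \<Phi>W U' in auto)
      qed (use inj\<Phi> bij_is_inj in auto)
      then show "hd_on k V (\<lambda>x. \<Phi>' x v)"
        using hd_on_cong[OF V(1), of "\<lambda>x. \<Phi>' x v"] d\<Phi>' by auto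
    qed
  qed
  define U where "U = U' \<inter> \<psi> -` ball (\<psi> z0) \<delta>"
  have "open U"
    unfolding U_def using hom U'(1) open_ball
    by (auto simp: homeomorphism_def intro: continuous_open_preimage)
  moreover have "homeomorphism U (ball (\<psi> z0) \<delta>) \<psi> \<Phi>"
    unfolding homeomorphism_def
  proof (intro conjI)
    show "\<psi> ` U = ball (\<psi> z0) \<delta>"
    proof
      show "ball (\<psi> z0) \<delta> \<subseteq> \<psi> ` U"
      proof
        fix y assume y: "y \<in> ball (\<psi> z0) \<delta>"
        then have "\<Phi> y \<in> U" "\<psi> (\<Phi> y) = y"
          using \<Phi>W[of y] \<delta>(2) by (auto simp: U_def)
        then show "y \<in> \<psi> ` U" by (metis imageI)
      qed
    qed (auto simp: U_def)
    show "\<Phi> ` ball (\<psi> z0) \<delta> = U"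
    proof
      show "\<Phi> ` ball (\<psi> z0) \<delta> \<subseteq> U"
        using \<Phi>W \<delta>(2) by (auto simp: U_def subset_iff)
      show "U \<subseteq> \<Phi> ` ball (\<psi> z0) \<delta>"
      proof
        fix z assume "z \<in> U"
        then have "\<psi> z \<in> ball (\<psi> z0) \<delta>" "\<Phi> (\<psi> z) = z"
          using hom by (auto simp: U_def homeomorphism_def)
        then show "z \<in> \<Phi> ` ball (\<psi> z0) \<delta>" by (metis imageI)
      qed
    qed
    show "\<forall>x\<in>U. \<Phi> (\<psi> x) = x" "\<forall>y\<in>ball (\<psi> z0) \<delta>. \<psi> (\<Phi> y) = y"
      using hom \<Phi>W(2) \<delta>(2) by (auto simp: U_def homeomorphism_def)
    show "continuous_on U \<psi>" "continuous_on (ball (\<psi> z0) \<delta>) \<Phi>"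
      using hom \<delta>(2) by (auto simp: U_def homeomorphism_def intro: continuous_on_subset)
  qed
  moreover have "smooth_on (ball (\<psi> z0) \<delta>) \<Phi>"
    using hd \<delta>(2) by (auto simp: smooth_on_def intro: hd_on_subset)
  moreover have "bij (frechet_derivative \<psi> (at z))" if "z \<in> U" for z
    using that inj\<Phi>(2)[of "\<psi> z"] hom by (auto simp: U_def homeomorphism_def)
  moreover have "z0 \<in> U" "U \<subseteq> W"
    using U' \<delta> by (auto simp: U_def)
  ultimately show thesis
    using that \<delta>(1) by blast
qed

text \<open>In the chart \<psi> the derivative of \<open>F\<close> sees the \<open>k\<close>-th
  component only, and the image is a ball, so \<open>F\<close> is a function of that coordinate
  alone. The curve \<gamma> is the preimage of the diameter parallel to the \<open>k\<close>-th
  axis, parametrised by the value of the coordinate.\<close>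

lemma factor_through_coordinate:
  fixes \<psi> :: "real^'d \<Rightarrow> real^'d" and F c :: "real^'d \<Rightarrow> real"
  assumes U: "open U" "U \<subseteq> W" and \<psi>: "smooth_on W \<psi>" and F: "smooth_on W F"
    and hom: "homeomorphism U (ball a \<delta>) \<psi> \<Phi>" and \<Phi>: "smooth_on (ball a \<delta>) \<Phi>" and \<delta>: "\<delta> > 0"
    and dF: "\<forall>z\<in>U. \<forall>u. frechet_derivative F (at z) u = c z * (frechet_derivative \<psi> (at z) u $ k)"
  defines "\<gamma> \<equiv> (\<lambda>\<tau>. \<Phi> (a + (\<tau> - a $ k) *\<^sub>R axis k 1))" and "I \<equiv> {a $ k - \<delta><..<a $ k + \<delta>}"
  shows "smooth_on I (\<lambda>\<tau>. F (\<gamma> \<tau>))"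
    and "\<And>\<tau>. \<tau> \<in> I \<Longrightarrow> ((\<lambda>\<tau>. F (\<gamma> \<tau>)) has_real_derivative c (\<gamma> \<tau>)) (at \<tau>)"
    and "\<And>\<tau>. \<tau> \<in> I \<Longrightarrow> \<gamma> \<tau> \<in> U \<and> \<psi> (\<gamma> \<tau>) $ k = \<tau>"
    and "\<And>z. z \<in> U \<Longrightarrow> \<psi> z $ k \<in> I \<and> F z = F (\<gamma> (\<psi> z $ k))"
proof -
  define L where "L \<tau> = a + (\<tau> - a $ k) *\<^sub>R axis k (1::real)" for \<tau>
  have \<gamma>: "\<gamma> \<tau> = \<Phi> (L \<tau>)" for \<tau>
    by (simp add: \<gamma>_def L_def)
  have Lk: "L \<tau> $ k = \<tau>" for \<tau>
    by (simp add: L_def axis_def)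
  have Lball: "L \<tau> \<in> ball a \<delta> \<longleftrightarrow> \<tau> \<in> I" for \<tau>
    by (auto simp: L_def I_def dist_norm norm_minus_commute abs_less_iff)
  have \<Phi>U: "\<Phi> y \<in> U" "\<psi> (\<Phi> y) = y" if "y \<in> ball a \<delta>" for y
    using hom that by (auto simp: homeomorphism_def)
  have \<Phi>W: "\<Phi> ` ball a \<delta> \<subseteq> W" using \<Phi>U(1) U(2) by auto
  have smG: "smooth_on (ball a \<delta>) (\<lambda>y. F (\<Phi> y))"
    by (rule smooth_on_compose[OF open_ball U(1) _ \<Phi> smooth_on_subset[OF F U(2)]]) (use \<Phi>U in auto)
  \<comment> \<open>Differentiating \<open>\<psi> (\<Phi> y) = y\<close> cancels the derivatives of
    \<psi> and \<Phi> in the chain rule.\<close>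
  have dG: "((\<lambda>y. F (\<Phi> y)) has_derivative (\<lambda>u. c (\<Phi> y) * (u $ k))) (at y)" if "y \<in> ball a \<delta>" for y
  proof -
    note d\<Phi> = smooth_on_has_derivative[OF \<Phi> that]
    have yW: "\<Phi> y \<in> W" using \<Phi>W that by auto
    have "((\<lambda>y. \<psi> (\<Phi> y)) has_derivative (\<lambda>u. frechet_derivative \<psi> (at (\<Phi> y)) (frechet_derivative \<Phi> (at y) u))) (at y)"
      by (rule has_derivative_compose[OF d\<Phi> smooth_on_has_derivative[OF \<psi> yW]])
    then have "((\<lambda>y. y) has_derivative (\<lambda>u. frechet_derivative \<psi> (at (\<Phi> y)) (frechet_derivative \<Phi> (at y) u))) (at y)"
      by (rule has_derivative_transform_within_open[OF _ open_ball that]) (use \<Phi>U in auto)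
    then have "(\<lambda>u. frechet_derivative \<psi> (at (\<Phi> y)) (frechet_derivative \<Phi> (at y) u)) = (\<lambda>u. u)"
      using has_derivative_unique has_derivative_ident by blast
    moreover have "((\<lambda>y. F (\<Phi> y)) has_derivative (\<lambda>u. frechet_derivative F (at (\<Phi> y)) (frechet_derivative \<Phi> (at y) u))) (at y)"
      by (rule has_derivative_compose[OF d\<Phi> smooth_on_has_derivative[OF F yW]])
    ultimately show ?thesis
      using \<Phi>U(1)[OF that] by (simp add: dF fun_eq_iff)
  qed
  have oI: "open I" by (simp add: I_def)
  have smL: "smooth_on I L"
    unfolding smooth_on_def L_def
    by (intro allI hd_on_add[OF oI] hd_on_scaleR[OF oI] hd_on_diff[OF oI] hd_on_const hd_on_ident[OF oI])
  show "smooth_on I (\<lambda>\<tau>. F (\<gamma> \<tau>))"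
    unfolding \<gamma> by (rule smooth_on_compose[OF oI open_ball _ smL smG]) (use Lball in auto)
  show "((\<lambda>\<tau>. F (\<gamma> \<tau>)) has_real_derivative c (\<gamma> \<tau>)) (at \<tau>)" if "\<tau> \<in> I" for \<tau>
  proof -
    have "(L has_derivative (\<lambda>h. h *\<^sub>R axis k 1)) (at \<tau>)"
      unfolding L_def by (auto intro!: derivative_eq_intros)
    from has_derivative_compose[OF this dG] Lball that
    show ?thesis
      unfolding \<gamma> has_field_derivative_def by (simp add: axis_def)
  qed
  show "\<gamma> \<tau> \<in> U \<and> \<psi> (\<gamma> \<tau>) $ k = \<tau>" if "\<tau> \<in> I" for \<tau>
    using \<Phi>U[of "L \<tau>"] that Lball Lk by (simp add: \<gamma>)
  show "\<psi> z $ k \<in> I \<and> F z = F (\<gamma> (\<psi> z $ k))" if "z \<in> U" for z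
  proof
    define y where "y = \<psi> z"
    have y: "y \<in> ball a \<delta>" "\<Phi> y = z"
      using hom that by (auto simp: y_def homeomorphism_def)
    have "\<bar>y $ k - a $ k\<bar> \<le> norm (y - a)"
      using component_le_norm_cart[of "y - a" k] by simp
    then show I: "\<psi> z $ k \<in> I"
      using y(1) by (auto simp: y_def[symmetric] I_def dist_norm norm_minus_commute)
    \<comment> \<open>The segment to \<open>y\<close> from the point of the diameter with the same
      \<open>k\<close>-th component. It stays in the ball by convexity, and its direction has
      \<open>k\<close>-th component 0, so \<open>F (\<Phi> (p r))\<close> has zero
      derivative.\<close>
    define p where "p r = L (y $ k) + r *\<^sub>R (y - L (y $ k))" for r :: real
    have p: "p r \<in> ball a \<delta>" if "r \<in> {0..1}" for r
    proof -
      have "p r = (1 - r) *\<^sub>R L (y $ k) + r *\<^sub>R y"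
        by (simp add: p_def algebra_simps)
      then show ?thesis
        using convexD_alt[OF convex_ball, of "L (y $ k)" a \<delta> y r] that Lball I y(1) by (auto simp: y_def)
    qed
    have "((\<lambda>r. F (\<Phi> (p r))) has_derivative (\<lambda>h. 0)) (at r within {0..1})" if "r \<in> {0..1}" for r
    proof -
      have "(p has_derivative (\<lambda>h. h *\<^sub>R (y - L (y $ k)))) (at r)"
        unfolding p_def by (auto intro!: derivative_eq_intros)
      from has_derivative_compose[OF this dG[OF p[OF that]]]
      show ?thesis
        by (auto simp: Lk intro: has_derivative_at_withinI)
    qed
    then have "F (\<Phi> (p 1)) = F (\<Phi> (p 0))"
      by (intro has_derivative_zero_unique[of "{0..1}" "\<lambda>r. F (\<Phi> (p r))"]) auto
    then show "F z = F (\<gamma> (\<psi> z $ k))"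
      using y(2) by (simp add: p_def \<gamma> y_def)
  qed
qed

section \<open>Antiderivatives of functions of one variable\<close>

lemma smooth_primitive:
  fixes q :: "real \<Rightarrow> real"
  assumes "open S" "\<And>t. t \<in> S \<Longrightarrow> (G has_real_derivative q t) (at t)" "smooth_on S q"
  shows "smooth_on S G"
proof (rule smooth_onI)
  fix k
  show "hd_on k S G"
  proof (rule hd_on_SucD, rule hd_on_SucI[OF assms(1)])
    show "(G has_derivative (*) (q t)) (at t)" if "t \<in> S" for t
      using assms(2)[OF that] by (simp add: has_field_derivative_def)
    show "hd_on k S (\<lambda>x. q x * v)" for v
      by (intro hd_on_mult hd_on_const assms(1) smooth_onD[OF assms(3)])
  qed
qed

lemma antiderivative_exists:
  fixes q :: "real \<Rightarrow> real"
  assumes "continuous_on {a..b} q"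
  obtains G where "\<And>t. t \<in> {a<..<b} \<Longrightarrow> (G has_real_derivative q t) (at t)"
proof -
  obtain G where G: "\<And>t. t \<in> {a..b} \<Longrightarrow> (G has_vector_derivative q t) (at t within {a..b})"
    using antiderivative_continuous[OF assms] by blast
  have "(G has_real_derivative q t) (at t)" if "t \<in> {a<..<b}" for t
    using G[of t] that at_within_interior[of t "{a..b}"]
    by (simp add: has_real_derivative_iff_has_vector_derivative)
  then show thesis using that by blast
qed

subsection \<open>The para-complex structure\<close>

lemma Jt_Jt [simp]: "Jt (Jt w) = w"
  by (simp add: Jt_def)

lemma linear_Jt: "linear (Jt :: 'a::real_vector \<times> 'a \<Rightarrow> 'a \<times> 'a)"
  by (rule linearI) (auto simp: Jt_def)

lemma bounded_linear_Jt: "bounded_linear (Jt :: 'a::euclidean_space \<times> 'a \<Rightarrow> 'a \<times> 'a)"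
  by (simp add: linear_Jt linear_linear)

lemmas Jt_simps = linear_add[OF linear_Jt] linear_diff[OF linear_Jt] linear_scale[OF linear_Jt]
  linear_neg[OF linear_Jt] linear_0[OF linear_Jt]

lemma inner_Jt: "Jt a \<bullet> b = a \<bullet> Jt b"
  by (simp add: Jt_def inner_prod_def)

lemma Jt_eq_0_iff: "Jt w = 0 \<longleftrightarrow> w = 0"
  by (auto simp: Jt_def prod_eq_iff)

subsection \<open>Hypersurfaces with a \<open>J\<close>-tangent transversal field in coordinates\<close>

lemma parallel_if_orthogonal:
  fixes a b :: "'v::euclidean_space"
  assumes "\<And>w. a \<bullet> w = 0 \<Longrightarrow> b \<bullet> w = 0"
  shows "\<exists>\<mu>. b = \<mu> *\<^sub>R a"
proof
  \<comment> \<open>For \<open>a = 0\<close> the quotient is 0, and the hypothesis then forces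
    \<open>b = 0\<close>.\<close>
  define \<mu> where "\<mu> = (b \<bullet> a) / (a \<bullet> a)"
  have a: "a \<bullet> (b - \<mu> *\<^sub>R a) = 0"
    by (cases "a = 0") (auto simp: \<mu>_def inner_diff_right inner_commute)
  then have "(b - \<mu> *\<^sub>R a) \<bullet> (b - \<mu> *\<^sub>R a) = 0"
    using assms[OF a] by (simp add: inner_diff_left)
  then show "b = \<mu> *\<^sub>R a" by simp
qed

text \<open>If every derivative of \<open>F\<close> is a multiple of \<open>F\<close>, the two terms
  in the derivative of \<open>F / norm F\<close> cancel, so this unit vector is constant on a convex
  set.\<close>

lemma sgn_constant:
  fixes F :: "'e::euclidean_space \<Rightarrow> 'v::euclidean_space"
  assumes B: "open B" "convex B" "z0 \<in> B" "z \<in> B"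
    and F: "\<And>z. z \<in> B \<Longrightarrow> (F has_derivative F' z) (at z)" "\<And>z. z \<in> B \<Longrightarrow> F z \<noteq> 0"
    and par: "\<And>z x. z \<in> B \<Longrightarrow> \<exists>\<mu>. F' z x = \<mu> *\<^sub>R F z"
  shows "sgn (F z) = sgn (F z0)"
proof -
  have "((\<lambda>z. sgn (F z)) has_derivative (\<lambda>x. 0)) (at z within B)" if z: "z \<in> B" for z
  proof -
    have n: "((\<lambda>z. norm (F z)) has_derivative (\<lambda>x. F' z x \<bullet> sgn (F z))) (at z)"
      using has_derivative_compose[OF F(1)[OF z] has_derivative_norm[OF F(2)[OF z]]]
      by (simp add: inner_commute)
    have "((\<lambda>z. inverse (norm (F z)) *\<^sub>R F z) has_derivative
        (\<lambda>x. inverse (norm (F z)) *\<^sub>R F' z x +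
          (- (inverse (norm (F z)) * (F' z x \<bullet> sgn (F z)) * inverse (norm (F z)))) *\<^sub>R F z)) (at z)"
      by (rule has_derivative_scaleR[OF Deriv.has_derivative_inverse[OF _ n] F(1)[OF z]])
        (use F(2)[OF z] in simp)
    moreover have "inverse (norm (F z)) *\<^sub>R F' z x +
          (- (inverse (norm (F z)) * (F' z x \<bullet> sgn (F z)) * inverse (norm (F z)))) *\<^sub>R F z = 0" for x
    proof -
      obtain \<mu> where \<mu>: "F' z x = \<mu> *\<^sub>R F z" using par[OF z] by blast
      have "F z \<bullet> sgn (F z) = norm (F z)"
        using F(2)[OF z] by (simp add: sgn_div_norm dot_square_norm power2_eq_square)
      then show ?thesis
        using F(2)[OF z] by (simp add: \<mu>)
    qed
    ultimately show ?thesis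
      by (simp add: sgn_div_norm has_derivative_at_withinI)
  qed
  then show ?thesis
    using has_derivative_zero_unique[OF B(2), of "\<lambda>z. sgn (F z)"] B by blast
qed

section \<open>Conormal field and Gauss decomposition\<close>

locale tangent_hypersurface =
  fixes W :: "(real^'d) set" and g :: "real^'d \<Rightarrow> 'k::finite para_space" and C :: "real^'d \<Rightarrow> 'k para_space"
  assumes W: "open W"
    and immersion: "immersion_on W g"
    and transversal: "transversal_on W g C"
    and tangent: "Jt_tangent_on W g C"
    and dim: "DIM('k para_space) = CARD('d) + 1"
begin

lemma smooth_g: "smooth_on W g" and smooth_C: "smooth_on W C"
  using immersion transversal by (auto simp: immersion_on_def transversal_on_def)

lemma linear_G: "z \<in> W \<Longrightarrow> linear (pushfwd g z)"
  using smooth_on_linear_frechet[OF smooth_g] by blast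

lemma inj_G: "z \<in> W \<Longrightarrow> inj (pushfwd g z)"
  using immersion by (auto simp: immersion_on_def)

lemma smooth_G: "smooth_on W Y \<Longrightarrow> smooth_on W (\<lambda>z. pushfwd g z (Y z))"
  using hd_on_frechet_apply[OF W smooth_onD[OF smooth_g]] by (auto simp: smooth_on_def)

lemma smooth_left_inv:
  "smooth_on W w \<Longrightarrow> smooth_on W (\<lambda>z. left_inv (pushfwd g z) (w z))"
  using hd_on_left_inv[OF W hd_on_frechet_apply[OF W smooth_onD[OF smooth_g] hd_on_const] _ linear_G inj_G]
  by (auto simp: smooth_on_def)

text \<open>The Euclidean inner product serves as an auxiliary metric: this is the component of
  \<open>C\<close> orthogonal to the tangent space.\<close>

definition normal :: "real^'d \<Rightarrow> 'k para_space" where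
  "normal z = C z - pushfwd g z (left_inv (pushfwd g z) (C z))"

text \<open>Represents, through the inner product, the 1-form that vanishes on the tangent space and
  takes the value 1 on \<open>C\<close>.\<close>

definition conormal :: "real^'d \<Rightarrow> 'k para_space" where
  "conormal z = (1 / (normal z \<bullet> normal z)) *\<^sub>R normal z"

lemma normal_nonzero: "z \<in> W \<Longrightarrow> normal z \<noteq> 0"
  using transversal by (auto simp: normal_def transversal_on_def)

lemma normal_G: "z \<in> W \<Longrightarrow> normal z \<bullet> pushfwd g z u = 0"
  using left_inv_normal_eq[OF linear_G inj_G, of z u "C z"]
  by (simp add: normal_def inner_diff_right inner_commute[of _ "pushfwd g z u"])

lemma conormal_G: "z \<in> W \<Longrightarrow> conormal z \<bullet> pushfwd g z u = 0"
  by (simp add: conormal_def normal_G)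

lemma conormal_C:
  assumes "z \<in> W"
  shows "conormal z \<bullet> C z = 1"
proof -
  obtain u where u: "C z = normal z + pushfwd g z u"
    unfolding normal_def by (metis diff_add_cancel)
  have "normal z \<bullet> C z = normal z \<bullet> normal z"
    by (simp add: u inner_add_right normal_G[OF assms])
  then show ?thesis
    using normal_nonzero[OF assms] by (simp add: conormal_def)
qed

lemma smooth_conormal: "smooth_on W conormal"
proof -
  have n: "hd_on k W normal" for k
    unfolding normal_def
    by (intro hd_on_diff W smooth_onD[OF smooth_C] smooth_onD[OF smooth_G[OF smooth_left_inv[OF smooth_C]]])
  show ?thesis
    unfolding smooth_on_def conormal_def
    by (intro allI hd_on_scaleR hd_on_divide hd_on_const hd_on_inner n W) (use normal_nonzero in auto)
qed

text \<open>By \<open>dim\<close> the tangent space has codimension 1, so together with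
  \<open>C z\<close> it spans everything; pairing with the conormal reads off the coefficient of
  \<open>C z\<close>.\<close>

lemma gauss_decomposition:
  assumes z: "z \<in> W"
  obtains u where "w = pushfwd g z u + (conormal z \<bullet> w) *\<^sub>R C z"
proof -
  let ?R = "range (pushfwd g z)"
  have R: "subspace ?R"
    using linear_subspace_image[OF linear_G[OF z] subspace_UNIV] .
  have "dim ?R = CARD('d)"
    using dim_image_eq[OF linear_G[OF z]] inj_G[OF z] by (simp add: dim_UNIV)
  moreover have "C z \<notin> span ?R"
    using transversal z R by (auto simp: transversal_on_def span_eq_iff[THEN iffD2])
  ultimately have "dim (insert (C z) ?R) = DIM('k para_space)"
    using dim by (simp add: dim_insert)
  then have "w \<in> span (insert (C z) ?R)"
    using dim_eq_full by blast
  then obtain r where "w - r *\<^sub>R C z \<in> ?R"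
    using R by (auto simp: span_breakdown_eq span_eq_iff[THEN iffD2])
  then obtain u where u: "w = pushfwd g z u + r *\<^sub>R C z"
    by (metis diff_add_cancel imageE)
  then have "conormal z \<bullet> w = r"
    by (simp add: inner_add_right conormal_G[OF z] conormal_C[OF z])
  with u show thesis using that by metis
qed

lemma tangential_part_eq:
  assumes "z \<in> W"
  shows "tangential_part g C z (pushfwd g z u + r *\<^sub>R C z) = u"
  unfolding tangential_part_def
proof (rule the_equality)
  fix u' assume "\<exists>r'. pushfwd g z u + r *\<^sub>R C z = pushfwd g z u' + r' *\<^sub>R C z"
  then obtain r' where r': "pushfwd g z u + r *\<^sub>R C z = pushfwd g z u' + r' *\<^sub>R C z" by blast
  then have "conormal z \<bullet> (pushfwd g z u + r *\<^sub>R C z) = conormal z \<bullet> (pushfwd g z u' + r' *\<^sub>R C z)"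
    by simp
  then have "r = r'"
    by (simp add: inner_add_right conormal_G[OF assms] conormal_C[OF assms])
  with r' show "u' = u"
    using inj_G[OF assms] by (simp add: inj_eq)
qed blast

lemma G_tangential_part:
  assumes "z \<in> W"
  shows "w = pushfwd g z (tangential_part g C z w) + (conormal z \<bullet> w) *\<^sub>R C z"
  using gauss_decomposition[OF assms, of w] tangential_part_eq[OF assms] by metis

section \<open>Formulas for \<xi>, \<D>, \<eta> and \<phi>\<close>

lemma G_xi:
  assumes "z \<in> W"
  shows "pushfwd g z (xi_field g C z) = Jt (C z)"
proof -
  obtain u where u: "pushfwd g z u = Jt (C z)"
    using tangent assms by (metis Jt_tangent_on_def imageE)
  then have "xi_field g C z = u"
    unfolding xi_field_def using inj_G[OF assms] by (metis (mono_tags, lifting) inj_eq the_equality)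
  with u show ?thesis by simp
qed

text \<open>Replaces the definite description by an expression whose smoothness in \<open>z\<close>
  is known.\<close>

lemma xi_eq_left_inv: "z \<in> W \<Longrightarrow> xi_field g C z = left_inv (pushfwd g z) (Jt (C z))"
  using left_inv_apply[OF linear_G inj_G] G_xi by metis

lemma conormal_Jt_C: "z \<in> W \<Longrightarrow> conormal z \<bullet> Jt (C z) = 0"
  using conormal_G G_xi by metis

text \<open>As J is an involution, a tangent vector lies in the J-image of the tangent space exactly
  when its own J-image is tangent, that is, annihilated by the conormal.\<close>

lemma distr_D_iff:
  assumes "z \<in> W"
  shows "u \<in> distr_D g z \<longleftrightarrow> conormal z \<bullet> Jt (pushfwd g z u) = 0"
proof
  assume "u \<in> distr_D g z"
  then obtain u' where "pushfwd g z u = Jt (pushfwd g z u')"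
    by (auto simp: distr_D_def)
  then show "conormal z \<bullet> Jt (pushfwd g z u) = 0"
    using conormal_G[OF assms] by simp
next
  assume "conormal z \<bullet> Jt (pushfwd g z u) = 0"
  then obtain u' where "Jt (pushfwd g z u) = pushfwd g z u'"
    using gauss_decomposition[OF assms, of "Jt (pushfwd g z u)"] by auto
  then have "pushfwd g z u = Jt (pushfwd g z u')"
    by (metis Jt_Jt)
  then have "pushfwd g z u \<in> range (pushfwd g z) \<inter> Jt ` range (pushfwd g z)"
    by (metis IntI imageI rangeI)
  then show "u \<in> distr_D g z"
    by (simp add: distr_D_def)
qed

text \<open>J maps the image of \<xi> back to \<open>C\<close>, where the conormal is 1; so
  subtracting this multiple of \<xi> is the projection to \<D> along \<xi>.\<close>

lemma distr_D_projection:
  assumes "z \<in> W"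
  shows "u - (conormal z \<bullet> Jt (pushfwd g z u)) *\<^sub>R xi_field g C z \<in> distr_D g z"
  using assms
  by (simp add: distr_D_iff linear_diff[OF linear_G] linear_scale[OF linear_G] G_xi Jt_simps
      inner_diff_right conormal_C)

lemma linear_conormal_Jt:
  assumes "z \<in> W"
  shows "linear (\<lambda>u. conormal z \<bullet> Jt (pushfwd g z u))"
  using linear_G[OF assms]
  by (intro linearI) (simp_all add: linear_add linear_scale Jt_simps inner_add_right)

lemma eta_form_eq:
  assumes z: "z \<in> W"
  shows "eta_form g C z u = conormal z \<bullet> Jt (pushfwd g z u)"
proof -
  have "eta_form g C z = (\<lambda>u. conormal z \<bullet> Jt (pushfwd g z u))"
    unfolding eta_form_def
  proof (rule the_equality, intro conjI ballI)
    show "linear (\<lambda>u. conormal z \<bullet> Jt (pushfwd g z u))"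
      by (rule linear_conormal_Jt[OF z])
    show "conormal z \<bullet> Jt (pushfwd g z (xi_field g C z)) = 1"
      by (simp add: G_xi[OF z] conormal_C[OF z])
    show "conormal z \<bullet> Jt (pushfwd g z u) = 0" if "u \<in> distr_D g z" for u
      using that distr_D_iff[OF z] by simp
    \<comment> \<open>Uniqueness: the projection along \<xi> splits each vector into a part in \<D>
      and a multiple of \<xi>, and on both the value of \<open>l\<close> is prescribed.\<close>
    fix l assume l: "linear l \<and> (\<forall>u\<in>distr_D g z. l u = 0) \<and> l (xi_field g C z) = (1::real)"
    show "l = (\<lambda>u. conormal z \<bullet> Jt (pushfwd g z u))"
    proof
      fix u
      have "l (u - (conormal z \<bullet> Jt (pushfwd g z u)) *\<^sub>R xi_field g C z) = 0"
        using l distr_D_projection[OF z] by blast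
      then show "l u = conormal z \<bullet> Jt (pushfwd g z u)"
        using l by (simp add: linear_diff linear_scale)
    qed
  qed
  then show ?thesis by simp
qed

text \<open>The J-image of a tangent vector minus its \<open>C\<close>-component is tangent, and on
  tangent vectors \<open>left_inv\<close> is an exact inverse.\<close>

lemma G_phi_left_inv:
  assumes z: "z \<in> W"
  shows "pushfwd g z (left_inv (pushfwd g z) (Jt (pushfwd g z u) - (conormal z \<bullet> Jt (pushfwd g z u)) *\<^sub>R C z))
    = Jt (pushfwd g z u) - (conormal z \<bullet> Jt (pushfwd g z u)) *\<^sub>R C z"
proof -
  obtain u' where u': "Jt (pushfwd g z u) = pushfwd g z u' + (conormal z \<bullet> Jt (pushfwd g z u)) *\<^sub>R C z"
    using gauss_decomposition[OF z, of "Jt (pushfwd g z u)"] .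
  then have "Jt (pushfwd g z u) - (conormal z \<bullet> Jt (pushfwd g z u)) *\<^sub>R C z = pushfwd g z u'"
    by (metis add_diff_cancel_right')
  then show ?thesis
    by (simp add: left_inv_apply[OF linear_G[OF z] inj_G[OF z]])
qed

text \<open>J followed by the projection along \<open>C\<close> to the tangent space has the
  defining properties of \<phi>: on \<D> the subtracted term vanishes, and \<xi> is sent to
  \<open>C - C = 0\<close>.\<close>

lemma G_phi:
  assumes z: "z \<in> W"
  shows "pushfwd g z (phi_tensor g C z u) = Jt (pushfwd g z u) - eta_form g C z u *\<^sub>R C z"
proof -
  let ?G = "pushfwd g z" and ?\<eta> = "\<lambda>u. conormal z \<bullet> Jt (pushfwd g z u)"
  define L where "L u = left_inv ?G (Jt (?G u) - ?\<eta> u *\<^sub>R C z)" for u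
  have GL: "?G (L u) = Jt (?G u) - ?\<eta> u *\<^sub>R C z" for u
    using G_phi_left_inv[OF z] by (simp add: L_def)
  note lin = linear_G[OF z]
  note inj = injD[OF inj_G[OF z]]
  have L: "linear L"
    by (rule linearI; rule inj)
      (simp_all add: GL linear_add[OF lin] linear_scale[OF lin] Jt_simps inner_add_right algebra_simps)
  have "phi_tensor g C z = L"
    unfolding phi_tensor_def
  proof (rule the_equality, intro conjI ballI)
    show "linear L" by (rule L)
    show "?G (L u) = Jt (?G u)" if "u \<in> distr_D g z" for u
      using that distr_D_iff[OF z] by (simp add: GL)
    show "L (xi_field g C z) = 0"
      by (rule inj) (simp add: GL G_xi[OF z] conormal_C[OF z] linear_0[OF lin])
    fix L' assume L': "linear L' \<and> (\<forall>u\<in>distr_D g z. ?G (L' u) = Jt (?G u)) \<and> L' (xi_field g C z) = 0"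
    show "L' = L"
    proof
      fix u
      let ?d = "u - ?\<eta> u *\<^sub>R xi_field g C z"
      have "L' u = L' ?d"
        using L' by (simp add: linear_diff linear_scale)
      moreover have "?G (L' ?d) = Jt (?G ?d)"
        using L' distr_D_projection[OF z] by blast
      ultimately show "L' u = L u"
        by (intro inj) (simp add: GL linear_diff[OF lin] linear_scale[OF lin] Jt_simps G_xi[OF z])
    qed
  qed
  then show ?thesis
    using GL eta_form_eq[OF z] by simp
qed

lemma xi_nonzero: "z \<in> W \<Longrightarrow> xi_field g C z \<noteq> 0"
  using G_xi[of z] conormal_C[of z] linear_0[OF linear_G[of z]] by (auto simp: Jt_eq_0_iff)

section \<open>Second fundamental form on \<D> and derivative of the conormal\<close>

lemma has_derivative_G:
  assumes "smooth_on W Y" "z \<in> W"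
  shows "((\<lambda>z. pushfwd g z (Y z)) has_derivative frechet_derivative (\<lambda>z. pushfwd g z (Y z)) (at z)) (at z)"
  using smooth_on_has_derivative[OF smooth_G[OF assms(1)] assms(2)] .

lemma frechet_derivative_Jt_G:
  assumes Y: "smooth_on W Y" and z: "z \<in> W"
    and Y': "\<And>z. z \<in> W \<Longrightarrow> pushfwd g z (Y' z) = Jt (pushfwd g z (Y z))"
  shows "frechet_derivative (\<lambda>z. pushfwd g z (Y' z)) (at z) x
    = Jt (frechet_derivative (\<lambda>z. pushfwd g z (Y z)) (at z) x)"
proof -
  have "((\<lambda>z. Jt (pushfwd g z (Y z))) has_derivative
      (\<lambda>x. Jt (frechet_derivative (\<lambda>z. pushfwd g z (Y z)) (at z) x))) (at z)"
    by (rule bounded_linear.has_derivative[OF bounded_linear_Jt has_derivative_G[OF Y z]])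
  then have "((\<lambda>z. pushfwd g z (Y' z)) has_derivative
      (\<lambda>x. Jt (frechet_derivative (\<lambda>z. pushfwd g z (Y z)) (at z) x))) (at z)"
    by (rule has_derivative_transform_within_open[OF _ W z]) (simp add: Y')
  then show ?thesis
    by (simp add: frechet_derivative_eq)
qed

text \<open>The quantity is \<open>h(x, Y)\<close>. For \<open>Y\<close> in \<D> the field \<phi> Y
  is J Y, and J turns the component \<open>h C\<close> of the derivative into
  \<open>h \<xi>\<close>. Hence the covariant derivative of \<phi>, applied to \<open>Y\<close>, is
  \<open>h \<xi>\<close>, and \<xi> is nonzero.\<close>

lemma second_form_zero_of_phi_parallel:
  assumes par: "phi_parallel_on W g C" and Y: "smooth_on W Y" and YD: "\<And>z. z \<in> W \<Longrightarrow> Y z \<in> distr_D g z"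
    and z: "z \<in> W"
  shows "conormal z \<bullet> frechet_derivative (\<lambda>z. pushfwd g z (Y z)) (at z) x = 0"
proof -
  define E where "E = frechet_derivative (\<lambda>z. pushfwd g z (Y z)) (at z) x"
  define a where "a = tangential_part g C z E"
  let ?h = "conormal z \<bullet> E"
  have "pushfwd g z (phi_tensor g C z (Y z)) = Jt (pushfwd g z (Y z))" if "z \<in> W" for z
    using G_phi[OF that] eta_form_eq[OF that] distr_D_iff[OF that] YD[OF that] by simp
  then have E': "frechet_derivative (\<lambda>z. pushfwd g z (phi_tensor g C z (Y z))) (at z) x = Jt E"
    using frechet_derivative_Jt_G[OF Y z, of "\<lambda>z. phi_tensor g C z (Y z)"] by (simp add: E_def)
  have E: "E = pushfwd g z a + ?h *\<^sub>R C z"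
    unfolding a_def by (rule G_tangential_part[OF z])
  have "Jt (pushfwd g z a) = pushfwd g z (phi_tensor g C z a) + eta_form g C z a *\<^sub>R C z"
    using G_phi[OF z] by simp
  then have "Jt E = pushfwd g z (phi_tensor g C z a + ?h *\<^sub>R xi_field g C z) + eta_form g C z a *\<^sub>R C z"
    by (subst E) (simp add: Jt_simps linear_add[OF linear_G[OF z]] linear_scale[OF linear_G[OF z]] G_xi[OF z])
  then have "tangential_part g C z (Jt E) = phi_tensor g C z a + ?h *\<^sub>R xi_field g C z"
    using tangential_part_eq[OF z] by simp
  moreover have "nabla g C (\<lambda>_. x) (\<lambda>z. phi_tensor g C z (Y z)) z - phi_tensor g C z (nabla g C (\<lambda>_. x) Y z) = 0"
    using par Y z by (auto simp: phi_parallel_on_def smooth_on_def hd_on_const)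
  ultimately have "?h *\<^sub>R xi_field g C z = 0"
    by (simp add: nabla_def flat_deriv_def E' flip: E_def a_def)
  then show ?thesis
    using xi_nonzero[OF z] by (simp add: E_def)
qed

text \<open>Parallelity is applied to the field \<open>Y'\<close>, which is J Y and lies in the
  kernel of \<eta>. Therefore \<eta> kills its covariant derivative, and since \<eta> is the
  conormal after J, this says that the \<open>C\<close>-component of the derivative of
  \<open>Y\<close> itself vanishes.\<close>

lemma second_form_zero_of_eta_parallel:
  assumes par: "eta_parallel_on W g C" and Y: "smooth_on W Y" and YD: "\<And>z. z \<in> W \<Longrightarrow> Y z \<in> distr_D g z"
    and z: "z \<in> W"
  shows "conormal z \<bullet> frechet_derivative (\<lambda>z. pushfwd g z (Y z)) (at z) x = 0"
proof -
  define E where "E = frechet_derivative (\<lambda>z. pushfwd g z (Y z)) (at z) x"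
  define Y' where "Y' z = left_inv (pushfwd g z) (Jt (pushfwd g z (Y z)))" for z
  have "smooth_on W (\<lambda>z. Jt (pushfwd g z (Y z)))"
    unfolding smooth_on_def
    by (intro allI hd_on_bounded_linear[OF W bounded_linear_Jt] smooth_onD[OF smooth_G[OF Y]])
  then have Y's: "smooth_on W Y'"
    unfolding Y'_def by (rule smooth_left_inv)
  have GY': "pushfwd g z (Y' z) = Jt (pushfwd g z (Y z))" if "z \<in> W" for z
    using G_phi_left_inv[OF that, of "Y z"] distr_D_iff[OF that] YD[OF that] by (simp add: Y'_def)
  have E': "frechet_derivative (\<lambda>z. pushfwd g z (Y' z)) (at z) x = Jt E"
    using frechet_derivative_Jt_G[OF Y z GY'] by (simp add: E_def)
  define a where "a = tangential_part g C z (Jt E)"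
  have a: "Jt E = pushfwd g z a + (conormal z \<bullet> Jt E) *\<^sub>R C z"
    unfolding a_def by (rule G_tangential_part[OF z])
  have "((\<lambda>z. eta_form g C z (Y' z)) has_derivative (\<lambda>x. 0)) (at z)"
    by (rule has_derivative_transform_within_open[OF _ W z, of "\<lambda>z. 0"])
      (simp_all add: eta_form_eq GY' conormal_G)
  moreover have "flat_deriv (\<lambda>_. x) (\<lambda>z. eta_form g C z (Y' z)) z - eta_form g C z (nabla g C (\<lambda>_. x) Y' z) = 0"
    using par Y's z by (auto simp: eta_parallel_on_def smooth_on_def hd_on_const)
  ultimately have "eta_form g C z a = 0"
    by (simp add: flat_deriv_def frechet_derivative_eq nabla_def E' flip: a_def)
  then have "conormal z \<bullet> Jt (pushfwd g z a) = 0"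
    by (simp add: eta_form_eq[OF z])
  then have "conormal z \<bullet> Jt (Jt E) = 0"
    by (subst a) (simp add: Jt_simps inner_add_right conormal_Jt_C[OF z])
  then show ?thesis by (simp add: E_def)
qed

text \<open>The vector \<open>w\<close> extends to a smooth section \<open>Y\<close> of \<D>.
  Differentiating the identity that the conormal kills \<open>Y\<close>, and using that
  \<open>h\<close> vanishes on \<D>, leaves the asserted equation.\<close>

lemma frechet_derivative_conormal:
  assumes par: "phi_parallel_on W g C \<or> eta_parallel_on W g C" and z: "z \<in> W"
    and w: "conormal z \<bullet> w = 0" "conormal z \<bullet> Jt w = 0"
  shows "frechet_derivative conormal (at z) x \<bullet> w = 0"
proof -
  obtain y where y: "w = pushfwd g z y"
    using gauss_decomposition[OF z, of w] w(1) by auto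
  \<comment> \<open>The constant field \<open>y\<close> projected to \<D> along \<xi>, with \<xi>
    written through \<open>left_inv\<close> to make smoothness available.\<close>
  define Y where "Y z = y - (conormal z \<bullet> Jt (pushfwd g z y)) *\<^sub>R left_inv (pushfwd g z) (Jt (C z))" for z
  have "hd_on k W Y" for k
    unfolding Y_def
    by (intro hd_on_diff hd_on_const hd_on_scaleR hd_on_inner W smooth_onD[OF smooth_conormal]
        hd_on_bounded_linear[OF _ bounded_linear_Jt] smooth_onD[OF smooth_G] smooth_onD[OF smooth_left_inv]
        smooth_onI smooth_onD[OF smooth_C])
  then have Y: "smooth_on W Y" by (rule smooth_onI)
  have YD: "Y z \<in> distr_D g z" if "z \<in> W" for z
    using distr_D_projection[OF that, of y] by (simp add: Y_def xi_eq_left_inv[OF that])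
  have Yz: "Y z = y"
    using w(2) by (simp add: Y_def y)
  let ?E = "frechet_derivative (\<lambda>z. pushfwd g z (Y z)) (at z)"
  have h: "conormal z \<bullet> ?E x = 0"
    using par second_form_zero_of_phi_parallel[OF _ Y YD z] second_form_zero_of_eta_parallel[OF _ Y YD z] by blast
  have "((\<lambda>z. conormal z \<bullet> pushfwd g z (Y z)) has_derivative
      (\<lambda>x. conormal z \<bullet> ?E x + frechet_derivative conormal (at z) x \<bullet> pushfwd g z (Y z))) (at z)"
    by (rule has_derivative_inner[OF smooth_on_has_derivative[OF smooth_conormal z] has_derivative_G[OF Y z]])
  moreover have "((\<lambda>z. conormal z \<bullet> pushfwd g z (Y z)) has_derivative (\<lambda>x. 0)) (at z)"
    by (rule has_derivative_transform_within_open[OF _ W z, of "\<lambda>z. 0"]) (simp_all add: conormal_G)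
  ultimately have "(\<lambda>x. conormal z \<bullet> ?E x + frechet_derivative conormal (at z) x \<bullet> pushfwd g z (Y z)) = (\<lambda>x. 0)"
    using has_derivative_unique by blast
  from fun_cong[OF this, of x] show ?thesis
    using h by (simp add: Yz y)
qed

text \<open>The vector is twice the component of the conormal in the \<epsilon>-eigenspace of J. It
  pairs to 1 with \<open>C\<close>, hence is nonzero, and its derivatives are multiples of itself,
  so \<open>sgn_constant\<close> applies.\<close>

lemma eigen_conormal_direction:
  assumes par: "phi_parallel_on W g C \<or> eta_parallel_on W g C" and r: "ball z0 r \<subseteq> W" and z: "z \<in> ball z0 r"
    and \<epsilon>: "\<epsilon> * \<epsilon> = (1::real)"
  shows "conormal z + \<epsilon> *\<^sub>R Jt (conormal z) \<noteq> 0"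
    and "sgn (conormal z + \<epsilon> *\<^sub>R Jt (conormal z)) = sgn (conormal z0 + \<epsilon> *\<^sub>R Jt (conormal z0))"
proof -
  define F where "F z = conormal z + \<epsilon> *\<^sub>R Jt (conormal z)" for z
  define F' where "F' z x = frechet_derivative conormal (at z) x + \<epsilon> *\<^sub>R Jt (frechet_derivative conormal (at z) x)" for z x
  have F0: "F z \<noteq> 0" if "z \<in> W" for z
  proof -
    have "F z \<bullet> C z = 1"
      by (simp add: F_def inner_add_left inner_Jt conormal_C[OF that] conormal_Jt_C[OF that])
    then show ?thesis by auto
  qed
  have dF: "(F has_derivative F' z) (at z)" if "z \<in> W" for z
    unfolding F_def F'_def
    by (intro has_derivative_add has_derivative_scaleR_right bounded_linear.has_derivative[OF bounded_linear_Jt]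
        smooth_on_has_derivative[OF smooth_conormal that])
  have F'F: "\<exists>\<mu>. F' z x = \<mu> *\<^sub>R F z" if zW: "z \<in> W" for z x
  proof (rule parallel_if_orthogonal)
    fix w assume w: "F z \<bullet> w = 0"
    \<comment> \<open>This vector lies in the \<epsilon>-eigenspace of J, so a single vanishing
      condition yields both hypotheses on it in \<open>frechet_derivative_conormal\<close>;
      self-adjointness of J carries the conclusion back to \<open>w\<close>.\<close>
    let ?w = "w + \<epsilon> *\<^sub>R Jt w"
    have "conormal z \<bullet> ?w = 0"
      using w by (simp add: F_def inner_add_left inner_add_right inner_Jt)
    moreover have "Jt ?w = \<epsilon> *\<^sub>R ?w"
      using \<epsilon> by (simp add: Jt_simps algebra_simps)
    ultimately have "frechet_derivative conormal (at z) x \<bullet> ?w = 0"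
      using frechet_derivative_conormal[OF par zW] by (metis inner_scaleR_right mult_zero_right)
    then show "F' z x \<bullet> w = 0"
      by (simp add: F'_def inner_add_left inner_add_right inner_Jt)
  qed
  show "conormal z + \<epsilon> *\<^sub>R Jt (conormal z) \<noteq> 0"
    using F0[of z] z r by (auto simp: F_def)
  have "z0 \<in> ball z0 r" using z zero_le_dist[of z0 z] by (auto simp del: zero_le_dist)
  then show "sgn (conormal z + \<epsilon> *\<^sub>R Jt (conormal z)) = sgn (conormal z0 + \<epsilon> *\<^sub>R Jt (conormal z0))"
    using sgn_constant[OF open_ball convex_ball _ z, of z0 F F'] dF F0 F'F r by (auto simp: F_def subset_iff)
qed

text \<open>Here \<open>a\<close> and \<open>a'\<close> are the constant unit directions of
  \<open>F 1\<close> and \<open>F (-1)\<close>. The sum \<open>F 1 + F (-1)\<close> is twice the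
  conormal and kills tangent vectors; solving for the \<open>a'\<close>-term gives \<rho> as a ratio
  of norms.\<close>

lemma constant_eigen_conormals:
  assumes par: "phi_parallel_on W g C \<or> eta_parallel_on W g C" and z0: "z0 \<in> W"
  obtains r a a' \<rho> where "r > 0" "ball z0 r \<subseteq> W" "a \<noteq> 0" "a' \<noteq> 0" "Jt a = a" "Jt a' = - a'"
    "\<forall>z\<in>ball z0 r. \<rho> z > 0"
    "\<forall>z\<in>ball z0 r. \<forall>u. a' \<bullet> pushfwd g z u = - \<rho> z * (a \<bullet> pushfwd g z u)"
proof -
  obtain r where r: "r > 0" "ball z0 r \<subseteq> W"
    using W z0 openE by blast
  define F where "F \<epsilon> z = conormal z + \<epsilon> *\<^sub>R Jt (conormal z)" for \<epsilon> z
  have F: "F \<epsilon> z \<noteq> 0" "sgn (F \<epsilon> z) = sgn (F \<epsilon> z0)" if "z \<in> ball z0 r" "\<epsilon> \<in> {1, -1}" for \<epsilon> z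
    using eigen_conormal_direction[OF par r(2) that(1), of \<epsilon>] that(2) by (auto simp: F_def)
  define \<rho> where "\<rho> z = norm (F 1 z) / norm (F (-1) z)" for z
  show thesis
  proof
    show "r > 0" "ball z0 r \<subseteq> W" by (fact r)+
    show "sgn (F 1 z0) \<noteq> 0" "sgn (F (-1) z0) \<noteq> 0"
      using F(1)[of z0] r(1) by (auto simp: sgn_zero_iff)
    show "Jt (sgn (F 1 z0)) = sgn (F 1 z0)" "Jt (sgn (F (-1) z0)) = - sgn (F (-1) z0)"
      by (simp_all add: sgn_div_norm F_def Jt_simps algebra_simps)
    show "\<forall>z\<in>ball z0 r. \<rho> z > 0"
      using F(1) by (simp add: \<rho>_def)
    show "\<forall>z\<in>ball z0 r. \<forall>u. sgn (F (-1) z0) \<bullet> pushfwd g z u = - \<rho> z * (sgn (F 1 z0) \<bullet> pushfwd g z u)"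
    proof (intro ballI allI)
      fix z u assume z: "z \<in> ball z0 r"
      have "F \<epsilon> z = norm (F \<epsilon> z) *\<^sub>R sgn (F \<epsilon> z0)" if "\<epsilon> \<in> {1, -1}" for \<epsilon>
        unfolding F(2)[OF z that, symmetric] using F(1)[OF z that] by (simp add: sgn_div_norm)
      then have "(norm (F 1 z) *\<^sub>R sgn (F 1 z0) + norm (F (-1) z) *\<^sub>R sgn (F (-1) z0)) \<bullet> pushfwd g z u
          = (F 1 z + F (-1) z) \<bullet> pushfwd g z u"
        by (metis insertCI)
      also have "\<dots> = 0"
        using conormal_G[of z u] z r(2) by (auto simp: F_def inner_add_left inner_diff_left)
      finally show "sgn (F (-1) z0) \<bullet> pushfwd g z u = - \<rho> z * (sgn (F 1 z0) \<bullet> pushfwd g z u)"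
        using F(1)[OF z] by (simp add: \<rho>_def inner_add_left field_simps)
    qed
  qed
qed

end

subsection \<open>Coordinates adapted to the eigenspaces of the para-complex structure\<close>

text \<open>The family \<open>h\<close> is an orthonormal basis of the hyperplane orthogonal to
  \<open>p\<close>; the last term is the projection to \<open>p\<close>.\<close>

lemma hyperplane_expansion:
  fixes p :: "real^'k"
  assumes "CARD('k) = n + 1" "p \<noteq> 0"
  obtains h where "\<And>i. i \<in> {1..n} \<Longrightarrow> p \<bullet> h i = 0"
    "\<And>x. x = (\<Sum>i=1..n. (h i \<bullet> x) *\<^sub>R h i) + (p \<bullet> x / (p \<bullet> p)) *\<^sub>R p"
proof -
  let ?H = "{x. p \<bullet> x = 0}"
  obtain B where B: "B \<subseteq> ?H" "pairwise orthogonal B" "\<And>x. x \<in> B \<Longrightarrow> norm x = 1"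
    "independent B" "card B = dim ?H" "span B = ?H"
    using orthonormal_basis_subspace[OF subspace_hyperplane[of p]] by metis
  have "finite B"
    using B(4) independent_imp_finite by blast
  moreover have "card B = n"
    using B(5) dim_hyperplane[OF assms(2)] assms(1) by simp
  ultimately obtain h where h: "bij_betw h {1..n} B"
    using ex_bij_betw_nat_finite_1 by blast
  have ph: "p \<bullet> h i = 0" if "i \<in> {1..n}" for i
    using bij_betwE[OF h] B(1) that by blast
  show thesis
  proof (rule that[of h, OF ph])
    fix x
    define x0 where "x0 = x - (p \<bullet> x / (p \<bullet> p)) *\<^sub>R p"
    have "x0 \<in> span B"
      using assms(2) by (simp add: B(6) x0_def inner_diff_right)
    then have "x0 = (\<Sum>v\<in>B. (v \<bullet> x0) *\<^sub>R v)"
      using orthonormal_basis_expand[OF B(2,3) _ \<open>finite B\<close>, of x0] by (simp add: inner_commute)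
    also have "\<dots> = (\<Sum>i=1..n. (h i \<bullet> x0) *\<^sub>R h i)"
      by (rule sum.reindex_bij_betw[OF h, symmetric])
    also have "\<dots> = (\<Sum>i=1..n. (h i \<bullet> x) *\<^sub>R h i)"
      by (rule sum.cong) (simp_all add: x0_def inner_diff_right ph inner_commute[of "h i" p for i])
    finally show "x = (\<Sum>i=1..n. (h i \<bullet> x) *\<^sub>R h i) + (p \<bullet> x / (p \<bullet> p)) *\<^sub>R p"
      by (simp only: x0_def diff_eq_eq)
  qed
qed

text \<open>Vectors fixed by J have the form \<open>(p, p)\<close>, negated ones the form
  \<open>(q, - q)\<close>. The \<open>b i\<close> come from orthonormal bases of the hyperplanes
  orthogonal to \<open>p\<close> and to \<open>q\<close>, and \<open>v\<close> from \<open>a\<close>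
  and \<open>a'\<close>.\<close>

lemma adapted_basis:
  fixes a a' :: "'k::finite para_space"
  assumes n: "CARD('k) = n + 1" and a: "a \<noteq> 0" "a' \<noteq> 0" "Jt a = a" "Jt a' = - a'"
  obtains b \<beta> v where "admissible_vectors n b v"
    "\<forall>w. w = (\<Sum>i=1..2*n. (\<beta> i \<bullet> w) *\<^sub>R b i)
        + ((a \<bullet> w) / 2) *\<^sub>R (v + Jt v) + ((a' \<bullet> w) / 2) *\<^sub>R (v - Jt v)"
proof -
  define p q where "p = fst a" and "q = fst a'"
  have ap: "a = (p, p)" "a' = (q, - q)"
    using arg_cong[OF a(3), of fst] arg_cong[OF a(4), of snd] by (simp_all add: Jt_def p_def q_def prod_eq_iff)
  then have pq: "p \<noteq> 0" "q \<noteq> 0"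
    using a(1,2) by (auto simp: zero_prod_def)
  obtain h where h: "\<And>i. i \<in> {1..n} \<Longrightarrow> p \<bullet> h i = 0"
    "\<And>x. x = (\<Sum>i=1..n. (h i \<bullet> x) *\<^sub>R h i) + (p \<bullet> x / (p \<bullet> p)) *\<^sub>R p"
    using hyperplane_expansion[OF n pq(1)] by blast
  obtain h' where h': "\<And>i. i \<in> {1..n} \<Longrightarrow> q \<bullet> h' i = 0"
    "\<And>x. x = (\<Sum>i=1..n. (h' i \<bullet> x) *\<^sub>R h' i) + (q \<bullet> x / (q \<bullet> q)) *\<^sub>R q"
    using hyperplane_expansion[OF n pq(2)] by blast
  define b where "b i = (if i \<le> n then (h i, h i) else (h' (i - n), - h' (i - n)))" for i
  \<comment> \<open>For a unit vector \<open>h\<close> the pair \<open>(h, h)\<close> has squared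
    norm 2, whence the factor 1/2 in the dual vector.\<close>
  define \<beta> where "\<beta> i = (1/2) *\<^sub>R b i" for i
  \<comment> \<open>Scaled so that \<open>a\<close> takes the value 2 on \<open>v + Jt v\<close> and
    \<open>a'\<close> the value 2 on \<open>v - Jt v\<close>, matching the halves in the
    expansion.\<close>
  define v where "v = (1 / (a \<bullet> a)) *\<^sub>R a + (1 / (a' \<bullet> a')) *\<^sub>R a'"
  have v: "v + Jt v = (2 / (a \<bullet> a)) *\<^sub>R a" "v - Jt v = (2 / (a' \<bullet> a')) *\<^sub>R a'"
    by (simp_all add: v_def Jt_simps a(3,4) flip: scaleR_add_left)
  have ex: "w = (\<Sum>i=1..2*n. (\<beta> i \<bullet> w) *\<^sub>R b i)
        + ((a \<bullet> w) / 2) *\<^sub>R (v + Jt v) + ((a' \<bullet> w) / 2) *\<^sub>R (v - Jt v)" for w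
  proof -
    \<comment> \<open>The two eigencomponents of \<open>w\<close>, each described by one vector of
      half the dimension.\<close>
    define x y where "x = (1/2) *\<^sub>R (fst w + snd w)" and "y = (1/2) *\<^sub>R (fst w - snd w)"
    have w: "w = (x, x) + (y, - y)"
      by (simp add: x_def y_def prod_eq_iff vec_eq_iff field_simps)
    have "(\<Sum>i=1..2*n. (\<beta> i \<bullet> w) *\<^sub>R b i)
        = (\<Sum>i=1..n. (\<beta> i \<bullet> w) *\<^sub>R b i) + (\<Sum>i=1+n..n+n. (\<beta> i \<bullet> w) *\<^sub>R b i)"
      using sum.ub_add_nat[of 1 n "\<lambda>i. (\<beta> i \<bullet> w) *\<^sub>R b i" n] by (simp add: mult_2 add.commute)
    also have "(\<Sum>i=1+n..n+n. (\<beta> i \<bullet> w) *\<^sub>R b i) = (\<Sum>i=1..n. (\<beta> (i + n) \<bullet> w) *\<^sub>R b (i + n))"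
      by (rule sum.shift_bounds_cl_nat_ivl)
    also have "\<dots> = (\<Sum>i=1..n. (h' i \<bullet> y) *\<^sub>R (h' i, - h' i))"
      by (rule sum.cong) (auto simp: \<beta>_def b_def w inner_prod_def inner_add_right inner_diff_right field_simps)
    also have "(\<Sum>i=1..n. (\<beta> i \<bullet> w) *\<^sub>R b i) = (\<Sum>i=1..n. (h i \<bullet> x) *\<^sub>R (h i, h i))"
      by (rule sum.cong) (auto simp: \<beta>_def b_def w inner_prod_def inner_add_right inner_diff_right field_simps)
    finally have S: "(\<Sum>i=1..2*n. (\<beta> i \<bullet> w) *\<^sub>R b i)
        = (\<Sum>i=1..n. (h i \<bullet> x) *\<^sub>R (h i, h i)) + (\<Sum>i=1..n. (h' i \<bullet> y) *\<^sub>R (h' i, - h' i))" .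
    have aw: "((a \<bullet> w) / 2) *\<^sub>R (v + Jt v) = (p \<bullet> x / (p \<bullet> p)) *\<^sub>R (p, p)"
      unfolding v unfolding ap w by (simp add: inner_prod_def inner_add_right inner_diff_right field_simps)
    have a'w: "((a' \<bullet> w) / 2) *\<^sub>R (v - Jt v) = (q \<bullet> y / (q \<bullet> q)) *\<^sub>R (q, - q)"
      unfolding v unfolding ap w by (simp add: inner_prod_def inner_add_right inner_diff_right field_simps)
    have x: "(x, x) = (\<Sum>i=1..n. (h i \<bullet> x) *\<^sub>R (h i, h i)) + (p \<bullet> x / (p \<bullet> p)) *\<^sub>R (p, p)"
      by (rule prod_eqI; subst h(2)[of x]) (simp_all add: fst_sum snd_sum)
    have y: "(y, - y) = (\<Sum>i=1..n. (h' i \<bullet> y) *\<^sub>R (h' i, - h' i)) + (q \<bullet> y / (q \<bullet> q)) *\<^sub>R (q, - q)"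
      by (rule prod_eqI; subst h'(2)[of y]) (simp_all add: fst_sum snd_sum sum_negf)
    note trans[OF w arg_cong2[where f = "(+)", OF x y]]
    then show ?thesis
      unfolding S aw a'w by (simp only: ac_simps)
  qed
  let ?vs = "map b [1..<2*n+1] @ [v, Jt v]"
  have b: "b i \<in> set ?vs" if "i \<in> {1..2*n}" for i
    unfolding set_append set_map set_upt using that by (intro UnI1 imageI) auto
  have "w \<in> span (set ?vs)" for w
    by (subst ex[of w]) (intro span_add span_diff span_mul span_sum span_base b; simp)
  then have span: "span (set ?vs) = UNIV" by blast
  \<comment> \<open>A spanning list whose length is the dimension \<open>2 * n + 2\<close> is
    distinct and independent.\<close>
  have D: "dim (UNIV :: 'k para_space set) = length ?vs"
    using n by (simp add: dim_UNIV)
  have "dim (UNIV :: 'k para_space set) \<le> card (set ?vs)"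
    by (rule span_card_ge_dim) (use span in auto)
  then have card: "card (set ?vs) = length ?vs"
    using D card_length[of ?vs] by linarith
  have "independent (set ?vs)"
    by (rule card_le_dim_spanning[of _ UNIV]) (use span card D in auto)
  moreover have "distinct ?vs"
    by (rule card_distinct[OF card])
  moreover have "Jt (b i) = b i" if "i \<in> {1..n}" for i
    using that by (auto simp: b_def Jt_def)
  moreover have "Jt (b i) = - b i" if "i \<in> {n+1..2*n}" for i
    using that by (auto simp: b_def Jt_def)
  ultimately have "admissible_vectors n b v"
    unfolding admissible_vectors_def Let_def by blast
  then show thesis using that ex by blast
qed

section \<open>Charts made of linear functionals of \<open>g\<close> and one further
  function\<close>

lemma frechet_derivative_inner_const:
  assumes "smooth_on W g" "z \<in> W"
  shows "frechet_derivative (\<lambda>z. c \<bullet> g z) (at z) u = c \<bullet> frechet_derivative g (at z) u"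
  using has_derivative_inner_right[OF smooth_on_has_derivative[OF assms], of c]
  by (simp add: frechet_derivative_eq)

lemma smooth_inner_const: "open W \<Longrightarrow> smooth_on W g \<Longrightarrow> smooth_on W (\<lambda>z. c \<bullet> g z)"
  unfolding smooth_on_def by (intro allI hd_on_inner hd_on_const) auto

lemma frechet_derivative_vec_nth:
  fixes f :: "'a::real_normed_vector \<Rightarrow> real^'n"
  assumes "smooth_on W f" "z \<in> W"
  shows "frechet_derivative f (at z) u $ j = frechet_derivative (\<lambda>z. f z $ j) (at z) u"
  using bounded_linear.has_derivative[OF bounded_linear_vec_nth smooth_on_has_derivative[OF assms], of j]
  by (simp add: frechet_derivative_eq)

lemma smooth_real_deriv:
  fixes F q :: "real \<Rightarrow> real"
  assumes "open S" "smooth_on S F" "\<And>t. t \<in> S \<Longrightarrow> (F has_real_derivative q t) (at t)"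
  shows "smooth_on S q"
proof -
  have "frechet_derivative F (at t) 1 = q t" if "t \<in> S" for t
    using assms(3)[OF that] by (simp add: has_field_derivative_def frechet_derivative_eq)
  moreover have "smooth_on S (\<lambda>t. frechet_derivative F (at t) 1)"
    by (rule smooth_onI) (use smooth_onD[OF assms(2), of "Suc k" for k] in simp)
  ultimately show ?thesis
    using smooth_on_cong[OF assms(1), of "\<lambda>t. frechet_derivative F (at t) 1" q] by blast
qed

text \<open>Here \<open>\<beta> i\<close> is dual to \<open>b i\<close>; \<open>s = a \<bullet> g\<close> and \<open>t = a' \<bullet> g\<close> are the coordinates of \<open>g\<close> along the
  eigenvectors \<open>(v + J v) / 2\<close> and \<open>(v - J v) / 2\<close>.\<close>

locale conormal_coordinates =
  fixes W :: "(real^'d) set" and g :: "real^'d \<Rightarrow> 'k::finite para_space" and a a' :: "'k para_space"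
    and n :: nat and e :: "nat \<Rightarrow> 'd" and b \<beta> :: "nat \<Rightarrow> 'k para_space" and v :: "'k para_space"
    and \<rho> :: "real^'d \<Rightarrow> real"
  assumes W: "open W" and smooth_g: "smooth_on W g"
    and inj_g: "\<And>z. z \<in> W \<Longrightarrow> inj (pushfwd g z)"
    and e: "bij_betw e {1..2*n+1} UNIV"
    and expansion: "\<And>w. w = (\<Sum>i=1..2*n. (\<beta> i \<bullet> w) *\<^sub>R b i)
        + ((a \<bullet> w) / 2) *\<^sub>R (v + Jt v) + ((a' \<bullet> w) / 2) *\<^sub>R (v - Jt v)"
    and \<rho>_pos: "\<And>z. z \<in> W \<Longrightarrow> \<rho> z > 0"
    and conormal_relation: "\<And>z u. z \<in> W \<Longrightarrow> a' \<bullet> pushfwd g z u = - \<rho> z * (a \<bullet> pushfwd g z u)"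
begin

definition "y_index = e (2*n+1)"

text \<open>The function \<open>y\<close> is a parameter because two charts are needed: one with
  \<open>y = s\<close>, from which the final \<open>y\<close> is constructed, and one with that
  final \<open>y\<close>.\<close>

definition coords :: "(real^'d \<Rightarrow> real) \<Rightarrow> real^'d \<Rightarrow> real^'d" where
  "coords y z = (\<chi> j. if j = y_index then y z else \<beta> (the_inv_into {1..2*n+1} e j) \<bullet> g z)"

lemma coords_y_index: "coords y z $ y_index = y z"
  by (simp add: coords_def)

lemma coords_e:
  assumes "i \<in> {1..2*n}"
  shows "coords y z $ e i = \<beta> i \<bullet> g z"
proof -
  have "inj_on e {1..2*n+1}"
    using e by (simp add: bij_betw_def)
  then have "e i \<noteq> y_index" "the_inv_into {1..2*n+1} e (e i) = i"
    using assms by (auto simp: y_index_def the_inv_into_f_f dest: inj_onD)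
  then show ?thesis by (simp add: coords_def)
qed

lemma smooth_coords:
  assumes V: "open V" "V \<subseteq> W" and y: "smooth_on V y"
  shows "smooth_on V (coords y)"
proof (rule smooth_onI)
  fix k
  show "hd_on k V (coords y)"
  proof (rule hd_on_vec[OF V(1)])
    fix j
    show "hd_on k V (\<lambda>z. coords y z $ j)"
      using smooth_onD[OF y] smooth_onD[OF smooth_inner_const[OF V(1) smooth_on_subset[OF smooth_g V(2)]]]
      by (cases "j = y_index") (simp_all add: coords_def)
  qed
qed

text \<open>If all coordinate differentials kill \<open>u\<close>, then every
  \<open>\<beta> i\<close>, \<open>a\<close> and, through the conormal relation, \<open>a'\<close>
  kill its image under the differential of \<open>g\<close>. By the expansion this image is
  zero.\<close>

lemma inj_coords:
  assumes V: "open V" "V \<subseteq> W" and y: "smooth_on V y" and z: "z \<in> V"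
    and dy: "\<And>u. frechet_derivative y (at z) u = 0 \<Longrightarrow> a \<bullet> pushfwd g z u = 0"
  shows "inj (pushfwd (coords y) z)"
proof -
  note sm = smooth_coords[OF V y]
  note smg = smooth_on_subset[OF smooth_g V(2)]
  have zW: "z \<in> W" using z V by auto
  have "u = 0" if u: "pushfwd (coords y) z u = 0" for u
  proof -
    have c: "frechet_derivative (\<lambda>z. coords y z $ j) (at z) u = 0" for j
      using frechet_derivative_vec_nth[OF sm z, of u j] u by simp
    have "a \<bullet> pushfwd g z u = 0"
      using c[of y_index] dy by (simp add: coords_y_index)
    moreover from this have "a' \<bullet> pushfwd g z u = 0"
      using conormal_relation[OF zW] by simp
    moreover have "\<beta> i \<bullet> pushfwd g z u = 0" if "i \<in> {1..2*n}" for i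
      using c[of "e i"] frechet_derivative_inner_const[OF smg z] by (simp add: coords_e[OF that])
    ultimately have "pushfwd g z u = 0"
      using expansion[of "pushfwd g z u"] by simp
    then show "u = 0"
      using inj_g[OF zW] smooth_on_linear_frechet[OF smooth_g zW] linear_injective_0 by blast
  qed
  then show ?thesis
    using linear_injective_0[OF smooth_on_linear_frechet[OF sm z]] by blast
qed

text \<open>A function \<open>y\<close> with \<open>dy = \<kappa> ds\<close> and nonvanishing
  \<kappa> completes the functions \<open>\<beta> i \<bullet> g\<close> to a chart. There
  \<open>ds = dy / \<kappa>\<close> and \<open>dt = (\<mu> / \<kappa>) dy\<close>, so that both
  \<open>s\<close> and \<open>t\<close> are functions of \<open>y\<close>.\<close>

lemma coords_chart:
  assumes V: "open V" "V \<subseteq> W" "z0 \<in> V" and y: "smooth_on V y"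
    and lam: "\<And>z. z \<in> V \<Longrightarrow> \<kappa> z \<noteq> 0"
    and dy: "\<And>z u. z \<in> V \<Longrightarrow> frechet_derivative y (at z) u = \<kappa> z * (a \<bullet> pushfwd g z u)"
    and dt: "\<And>z u. z \<in> V \<Longrightarrow> a' \<bullet> pushfwd g z u = \<mu> z * (a \<bullet> pushfwd g z u)"
  obtains U \<Phi> \<delta> \<gamma> where "open U" "z0 \<in> U" "U \<subseteq> V" "\<delta> > 0"
    "homeomorphism U (ball (coords y z0) \<delta>) (coords y) \<Phi>" "smooth_on (ball (coords y z0) \<delta>) \<Phi>"
    "\<forall>\<tau>\<in>{y z0 - \<delta><..<y z0 + \<delta>}. \<gamma> \<tau> \<in> U \<and> y (\<gamma> \<tau>) = \<tau>"
    "\<forall>z\<in>U. y z \<in> {y z0 - \<delta><..<y z0 + \<delta>} \<and> a \<bullet> g z = a \<bullet> g (\<gamma> (y z)) \<and> a' \<bullet> g z = a' \<bullet> g (\<gamma> (y z))"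
    "smooth_on {y z0 - \<delta><..<y z0 + \<delta>} (\<lambda>\<tau>. a \<bullet> g (\<gamma> \<tau>))"
    "smooth_on {y z0 - \<delta><..<y z0 + \<delta>} (\<lambda>\<tau>. a' \<bullet> g (\<gamma> \<tau>))"
    "\<forall>\<tau>\<in>{y z0 - \<delta><..<y z0 + \<delta>}. ((\<lambda>\<tau>. a \<bullet> g (\<gamma> \<tau>)) has_real_derivative 1 / \<kappa> (\<gamma> \<tau>)) (at \<tau>)"
    "\<forall>\<tau>\<in>{y z0 - \<delta><..<y z0 + \<delta>}. ((\<lambda>\<tau>. a' \<bullet> g (\<gamma> \<tau>)) has_real_derivative \<mu> (\<gamma> \<tau>) / \<kappa> (\<gamma> \<tau>)) (at \<tau>)"
proof -
  note sm = smooth_coords[OF V(1,2) y]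
  note smg = smooth_on_subset[OF smooth_g V(2)]
  have "inj (pushfwd (coords y) z0)"
    by (rule inj_coords[OF V(1,2) y V(3)]) (use dy[OF V(3)] lam[OF V(3)] in auto)
  then obtain U \<Phi> \<delta> where U: "open U" "z0 \<in> U" "U \<subseteq> V" "\<delta> > 0"
    and hom: "homeomorphism U (ball (coords y z0) \<delta>) (coords y) \<Phi>"
    and \<Phi>: "smooth_on (ball (coords y z0) \<delta>) \<Phi>"
    using smooth_local_inverse[OF V(1,3) sm] by metis
  have dlast: "pushfwd (coords y) z u $ y_index = \<kappa> z * (a \<bullet> pushfwd g z u)" if "z \<in> U" for z u
    using frechet_derivative_vec_nth[OF sm, of z u y_index] dy[of z u] U(3) that by (auto simp: coords_y_index)
  define \<gamma> where "\<gamma> \<tau> = \<Phi> (coords y z0 + (\<tau> - coords y z0 $ y_index) *\<^sub>R axis y_index 1)" for \<tau>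
  have ds: "\<forall>z\<in>U. \<forall>u. frechet_derivative (\<lambda>z. a \<bullet> g z) (at z) u = 1 / \<kappa> z * (pushfwd (coords y) z u $ y_index)"
    using U(3) lam by (auto simp: dlast frechet_derivative_inner_const[OF smg])
  have dt': "\<forall>z\<in>U. \<forall>u. frechet_derivative (\<lambda>z. a' \<bullet> g z) (at z) u = \<mu> z / \<kappa> z * (pushfwd (coords y) z u $ y_index)"
    using U(3) lam dt by (auto simp: dlast frechet_derivative_inner_const[OF smg])
  note fs = factor_through_coordinate[OF U(1,3) sm smooth_inner_const[OF V(1) smg] hom \<Phi> U(4) ds,
      folded \<gamma>_def, unfolded coords_y_index]
  note ft = factor_through_coordinate[OF U(1,3) sm smooth_inner_const[OF V(1) smg] hom \<Phi> U(4) dt',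
      folded \<gamma>_def, unfolded coords_y_index]
  have f: "y z \<in> {y z0 - \<delta><..<y z0 + \<delta>} \<and> a \<bullet> g z = a \<bullet> g (\<gamma> (y z)) \<and> a' \<bullet> g z = a' \<bullet> g (\<gamma> (y z))"
    if "z \<in> U" for z
    using fs(4)[OF that] ft(4)[OF that] by blast
  show thesis
    by (rule that[OF U hom \<Phi> _ _ fs(1) ft(1)]) (use fs(2,3) ft(2) f in blast)+
qed

text \<open>\<open>coords_chart\<close> is used twice. With \<open>y = s\<close> it makes
  \<open>t\<close> a function of \<open>s\<close>, so that \<rho> can be replaced by a smooth
  function of \<open>s\<close>. With \<open>y\<close> a primitive of its square root, the
  derivatives of \<open>s\<close> and \<open>t\<close> along \<open>y\<close> become exp \<alpha>
  and - exp (- \<alpha>).\<close>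

lemma normal_form_coordinates:
  assumes z0: "z0 \<in> W"
  obtains U \<psi> \<Phi> r I \<alpha> P Q where "open U" "z0 \<in> U" "U \<subseteq> W"
    "homeomorphism U (ball (\<psi> z0) r) \<psi> \<Phi>" "smooth_on U \<psi>" "smooth_on (ball (\<psi> z0) r) \<Phi>"
    "profile I \<alpha> P Q" "\<And>z. z \<in> U \<Longrightarrow> \<psi> z $ e (2*n+1) \<in> I \<and> g z = normal_form n e b v P Q (\<psi> z)"
proof -
  define s where "s z = a \<bullet> g z" for z
  have sms: "smooth_on W s"
    unfolding s_def by (rule smooth_inner_const[OF W smooth_g])
  have ds: "frechet_derivative s (at z) u = a \<bullet> pushfwd g z u" if "z \<in> W" for z u
    unfolding s_def by (rule frechet_derivative_inner_const[OF smooth_g that])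
  have d1: "frechet_derivative s (at z) u = 1 * (a \<bullet> pushfwd g z u)" if "z \<in> W" for z u
    using ds[OF that] by simp
  obtain U\<^sub>0 \<Phi>\<^sub>0 \<delta>\<^sub>0 \<gamma>\<^sub>0 where U\<^sub>0: "open U\<^sub>0" "z0 \<in> U\<^sub>0" "U\<^sub>0 \<subseteq> W" "\<delta>\<^sub>0 > 0"
    and "homeomorphism U\<^sub>0 (ball (coords s z0) \<delta>\<^sub>0) (coords s) \<Phi>\<^sub>0" "smooth_on (ball (coords s z0) \<delta>\<^sub>0) \<Phi>\<^sub>0"
    and \<gamma>\<^sub>0: "\<forall>\<tau>\<in>{s z0 - \<delta>\<^sub>0<..<s z0 + \<delta>\<^sub>0}. \<gamma>\<^sub>0 \<tau> \<in> U\<^sub>0 \<and> s (\<gamma>\<^sub>0 \<tau>) = \<tau>"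
      "\<forall>z\<in>U\<^sub>0. s z \<in> {s z0 - \<delta>\<^sub>0<..<s z0 + \<delta>\<^sub>0} \<and> a \<bullet> g z = a \<bullet> g (\<gamma>\<^sub>0 (s z)) \<and> a' \<bullet> g z = a' \<bullet> g (\<gamma>\<^sub>0 (s z))"
      "smooth_on {s z0 - \<delta>\<^sub>0<..<s z0 + \<delta>\<^sub>0} (\<lambda>\<tau>. a \<bullet> g (\<gamma>\<^sub>0 \<tau>))"
      "smooth_on {s z0 - \<delta>\<^sub>0<..<s z0 + \<delta>\<^sub>0} (\<lambda>\<tau>. a' \<bullet> g (\<gamma>\<^sub>0 \<tau>))"
      "\<forall>\<tau>\<in>{s z0 - \<delta>\<^sub>0<..<s z0 + \<delta>\<^sub>0}. ((\<lambda>\<tau>. a \<bullet> g (\<gamma>\<^sub>0 \<tau>)) has_real_derivative 1 / 1) (at \<tau>)"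
      "\<forall>\<tau>\<in>{s z0 - \<delta>\<^sub>0<..<s z0 + \<delta>\<^sub>0}. ((\<lambda>\<tau>. a' \<bullet> g (\<gamma>\<^sub>0 \<tau>)) has_real_derivative - \<rho> (\<gamma>\<^sub>0 \<tau>) / 1) (at \<tau>)"
    by (rule coords_chart[where \<kappa> = "\<lambda>_. 1" and \<mu> = "\<lambda>z. - \<rho> z", OF W order_refl z0 sms one_neq_zero d1
          conormal_relation])
  define T where "T \<tau> = a' \<bullet> g (\<gamma>\<^sub>0 \<tau>)" for \<tau>
  define q where "q \<tau> = sqrt (\<rho> (\<gamma>\<^sub>0 \<tau>))" for \<tau>
  define J where "J = {s z0 - \<delta>\<^sub>0<..<s z0 + \<delta>\<^sub>0}"
  have oJ: "open J" by (simp add: J_def)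
  have qpos: "q \<tau> > 0" "\<rho> (\<gamma>\<^sub>0 \<tau>) > 0" "q \<tau> * q \<tau> = \<rho> (\<gamma>\<^sub>0 \<tau>)" if "\<tau> \<in> J" for \<tau>
  proof -
    have "\<gamma>\<^sub>0 \<tau> \<in> W"
      using \<gamma>\<^sub>0(1) U\<^sub>0(3) that unfolding J_def by blast
    from \<rho>_pos[OF this] show "q \<tau> > 0" "\<rho> (\<gamma>\<^sub>0 \<tau>) > 0" "q \<tau> * q \<tau> = \<rho> (\<gamma>\<^sub>0 \<tau>)"
      by (simp_all add: q_def)
  qed
  have dT: "(T has_real_derivative - \<rho> (\<gamma>\<^sub>0 \<tau>)) (at \<tau>)" if "\<tau> \<in> J" for \<tau>
    using \<gamma>\<^sub>0(6) that by (simp add: T_def[abs_def] J_def)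
  have smT: "smooth_on J T"
    using \<gamma>\<^sub>0(4) by (simp add: T_def[abs_def] J_def)
  \<comment> \<open>Smoothness of \<rho> is not assumed, but along \<open>\<gamma>\<^sub>0\<close>
    it is minus the derivative of the smooth function \<open>T\<close>.\<close>
  have "smooth_on J (\<lambda>\<tau>. - \<rho> (\<gamma>\<^sub>0 \<tau>))"
    using smooth_real_deriv[OF oJ smT dT] .
  then have sm\<rho>: "smooth_on J (\<lambda>\<tau>. \<rho> (\<gamma>\<^sub>0 \<tau>))"
    unfolding smooth_on_def using hd_on_minus[OF oJ, of _ "\<lambda>\<tau>. - \<rho> (\<gamma>\<^sub>0 \<tau>)"] by simp
  have smq: "smooth_on J q"
    unfolding q_def by (rule smooth_onI, rule hd_on_sqrt_compose[OF oJ smooth_onD[OF sm\<rho>] qpos(2)])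
  \<comment> \<open>Half the radius, so that the closed interval needed for the antiderivative lies
    inside \<open>J\<close>.\<close>
  define J' where "J' = {s z0 - \<delta>\<^sub>0/2<..<s z0 + \<delta>\<^sub>0/2}"
  have J': "open J'" "J' \<subseteq> J"
    using U\<^sub>0(4) by (auto simp: J_def J'_def)
  have "continuous_on {s z0 - \<delta>\<^sub>0/2..s z0 + \<delta>\<^sub>0/2} q"
    by (rule continuous_on_subset[OF hd_on_continuous[OF smooth_onD[OF smq]]])
      (use U\<^sub>0(4) in \<open>auto simp: J_def\<close>)
  then obtain Y where Y: "\<And>\<tau>. \<tau> \<in> J' \<Longrightarrow> (Y has_real_derivative q \<tau>) (at \<tau>)"
    using antiderivative_exists unfolding J'_def by metis
  have smY: "smooth_on J' Y"
    using smooth_primitive[OF J'(1) Y smooth_on_subset[OF smq J'(2)]] .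
  define V where "V = U\<^sub>0 \<inter> s -` J'"
  have V: "open V" "V \<subseteq> W" "z0 \<in> V"
  proof -
    have "continuous_on U\<^sub>0 s"
      using continuous_on_subset[OF hd_on_continuous[OF smooth_onD[OF sms]] U\<^sub>0(3)] .
    then show "open V"
      unfolding V_def by (rule continuous_open_preimage[OF _ U\<^sub>0(1) J'(1)])
  qed (use U\<^sub>0 in \<open>auto simp: V_def J'_def\<close>)
  have sV: "s z \<in> J'" "s z \<in> J" if "z \<in> V" for z
    using that J'(2) by (auto simp: V_def)
  have smVs: "smooth_on V s"
    using smooth_on_subset[OF sms V(2)] .
  define y where "y z = Y (s z)" for z
  have smy: "smooth_on V y"
    unfolding y_def by (rule smooth_on_compose[OF V(1) J'(1) _ smVs smY]) (use sV in auto)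
  have dc: "((\<lambda>z. F (s z)) has_derivative (\<lambda>u. D * (a \<bullet> pushfwd g z u))) (at z)"
    if "z \<in> V" "(F has_real_derivative D) (at (s z))" for F :: "real \<Rightarrow> real" and D z
  proof -
    have z: "z \<in> W" using V(2) that(1) by blast
    have "frechet_derivative s (at z) = (\<lambda>u. a \<bullet> pushfwd g z u)"
      by (rule ext) (rule ds[OF z])
    then have "(s has_derivative (\<lambda>u. a \<bullet> pushfwd g z u)) (at z)"
      using smooth_on_has_derivative[OF sms z] by simp
    from has_derivative_compose[OF this] that(2) show ?thesis
      by (simp add: has_field_derivative_def)
  qed
  have dy: "frechet_derivative y (at z) u = q (s z) * (a \<bullet> pushfwd g z u)" if "z \<in> V" for z u
    unfolding y_def using dc[OF that Y[OF sV(1)[OF that]]] by (simp add: frechet_derivative_eq)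
  \<comment> \<open>Follows from \<open>t = T(s)\<close> near \<open>z\<close>; the factor is now a
    function of \<open>s\<close>.\<close>
  have dt: "a' \<bullet> pushfwd g z u = - \<rho> (\<gamma>\<^sub>0 (s z)) * (a \<bullet> pushfwd g z u)" if z: "z \<in> V" for z u
  proof -
    have "((\<lambda>z. a' \<bullet> g z) has_derivative (\<lambda>u. - \<rho> (\<gamma>\<^sub>0 (s z)) * (a \<bullet> pushfwd g z u))) (at z)"
      by (rule has_derivative_transform_within_open[OF dc[OF z dT[OF sV(2)[OF z]]] U\<^sub>0(1)])
        (use z \<gamma>\<^sub>0(2) in \<open>auto simp: V_def T_def\<close>)
    then have "frechet_derivative (\<lambda>z. a' \<bullet> g z) (at z) u = - \<rho> (\<gamma>\<^sub>0 (s z)) * (a \<bullet> pushfwd g z u)"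
      by (simp add: frechet_derivative_eq)
    then show ?thesis
      using frechet_derivative_inner_const[OF smooth_g, of z a' u] z V(2) by auto
  qed
  have q0: "q (s z) \<noteq> 0" if "z \<in> V" for z
    using qpos(1)[OF sV(2)[OF that]] by simp
  obtain U \<Phi> r \<gamma> where U: "open U" "z0 \<in> U" "U \<subseteq> V" "r > 0"
    and hom: "homeomorphism U (ball (coords y z0) r) (coords y) \<Phi>"
    and \<Phi>: "smooth_on (ball (coords y z0) r) \<Phi>"
    and \<gamma>: "\<forall>\<tau>\<in>{y z0 - r<..<y z0 + r}. \<gamma> \<tau> \<in> U \<and> y (\<gamma> \<tau>) = \<tau>"
      "\<forall>z\<in>U. y z \<in> {y z0 - r<..<y z0 + r} \<and> a \<bullet> g z = a \<bullet> g (\<gamma> (y z)) \<and> a' \<bullet> g z = a' \<bullet> g (\<gamma> (y z))"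
      "smooth_on {y z0 - r<..<y z0 + r} (\<lambda>\<tau>. a \<bullet> g (\<gamma> \<tau>))"
      "smooth_on {y z0 - r<..<y z0 + r} (\<lambda>\<tau>. a' \<bullet> g (\<gamma> \<tau>))"
      "\<forall>\<tau>\<in>{y z0 - r<..<y z0 + r}. ((\<lambda>\<tau>. a \<bullet> g (\<gamma> \<tau>)) has_real_derivative 1 / q (s (\<gamma> \<tau>))) (at \<tau>)"
      "\<forall>\<tau>\<in>{y z0 - r<..<y z0 + r}. ((\<lambda>\<tau>. a' \<bullet> g (\<gamma> \<tau>)) has_real_derivative - \<rho> (\<gamma>\<^sub>0 (s (\<gamma> \<tau>))) / q (s (\<gamma> \<tau>))) (at \<tau>)"
    by (rule coords_chart[where \<kappa> = "\<lambda>z. q (s z)" and \<mu> = "\<lambda>z. - \<rho> (\<gamma>\<^sub>0 (s z))", OF V smy q0 dy dt])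
  define I where "I = {y z0 - r<..<y z0 + r}"
  \<comment> \<open>The derivative of \<open>s\<close> along \<open>y\<close>; its logarithm will be
    \<alpha>.\<close>
  define l where "l \<tau> = 1 / q (s (\<gamma> \<tau>))" for \<tau>
  \<comment> \<open>In the expansion \<open>s / 2\<close> multiplies \<open>v + Jt v\<close> and
    \<open>t / 2\<close> multiplies \<open>v - Jt v\<close>; regrouping gives
    \<open>(s - t) / 2\<close> as coefficient of \<open>Jt v\<close> and \<open>(s + t) / 2\<close>
    as coefficient of \<open>v\<close>.\<close>
  define P where "P \<tau> = (a \<bullet> g (\<gamma> \<tau>) - a' \<bullet> g (\<gamma> \<tau>)) / 2" for \<tau>
  define Q where "Q \<tau> = (a \<bullet> g (\<gamma> \<tau>) + a' \<bullet> g (\<gamma> \<tau>)) / 2" for \<tau>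
  have oI: "open I" by (simp add: I_def)
  have \<gamma>J: "s (\<gamma> \<tau>) \<in> J" if "\<tau> \<in> I" for \<tau>
    using \<gamma>(1) that U(3) sV(2) unfolding I_def by blast
  have lpos: "l \<tau> > 0" if "\<tau> \<in> I" for \<tau>
    using qpos(1)[OF \<gamma>J[OF that]] by (simp add: l_def)
  have dS: "((\<lambda>\<tau>. a \<bullet> g (\<gamma> \<tau>)) has_real_derivative l \<tau>) (at \<tau>)" if "\<tau> \<in> I" for \<tau>
    using \<gamma>(5) that by (simp add: I_def l_def)
  have dT2: "((\<lambda>\<tau>. a' \<bullet> g (\<gamma> \<tau>)) has_real_derivative - inverse (l \<tau>)) (at \<tau>)" if "\<tau> \<in> I" for \<tau>
  proof -
    have "- \<rho> (\<gamma>\<^sub>0 (s (\<gamma> \<tau>))) / q (s (\<gamma> \<tau>)) = - inverse (l \<tau>)"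
      using qpos(1)[OF \<gamma>J[OF that]] qpos(3)[OF \<gamma>J[OF that]] by (simp add: l_def field_simps)
    then show ?thesis using \<gamma>(6) that unfolding I_def by metis
  qed
  have sml: "smooth_on I l"
    by (rule smooth_real_deriv[OF oI _ dS]) (use \<gamma>(3) in \<open>simp_all add: I_def\<close>)
  have "smooth_on I (\<lambda>\<tau>. ln (l \<tau>))"
    by (rule smooth_onI, rule hd_on_ln_compose[OF oI smooth_onD[OF sml] lpos])
  moreover have "(P has_real_derivative cosh (ln (l \<tau>))) (at \<tau>)" if "\<tau> \<in> I" for \<tau>
    unfolding P_def cosh_ln_real[OF lpos[OF that]]
    using DERIV_diff[OF dS[OF that] dT2[OF that], THEN DERIV_cdivide, of 2] by simp
  moreover have "(Q has_real_derivative sinh (ln (l \<tau>))) (at \<tau>)" if "\<tau> \<in> I" for \<tau>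
    unfolding Q_def sinh_ln_real[OF lpos[OF that]]
    using DERIV_add[OF dS[OF that] dT2[OF that], THEN DERIV_cdivide, of 2] by simp
  ultimately have prof: "profile I (\<lambda>\<tau>. ln (l \<tau>)) P Q"
    using oI by (simp add: profile_def I_def is_interval_oo)
  have nf: "coords y z $ e (2*n+1) \<in> I \<and> g z = normal_form n e b v P Q (coords y z)" if z: "z \<in> U" for z
  proof
    show "coords y z $ e (2*n+1) \<in> I"
      using \<gamma>(2) z unfolding y_index_def[symmetric] by (simp add: coords_y_index I_def)
    have "(\<Sum>i=1..2*n. (coords y z $ e i) *\<^sub>R b i) = (\<Sum>i=1..2*n. (\<beta> i \<bullet> g z) *\<^sub>R b i)"
      by (rule sum.cong) (simp_all add: coords_e)
    moreover have "P (coords y z $ y_index) *\<^sub>R Jt v + Q (coords y z $ y_index) *\<^sub>R v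
        = ((a \<bullet> g z) / 2) *\<^sub>R (v + Jt v) + ((a' \<bullet> g z) / 2) *\<^sub>R (v - Jt v)"
      using \<gamma>(2) z by (simp add: coords_y_index P_def Q_def algebra_simps add_divide_distrib diff_divide_distrib)
    ultimately show "g z = normal_form n e b v P Q (coords y z)"
      using expansion[of "g z"] unfolding normal_form_def y_index_def[symmetric] by (simp add: add.assoc)
  qed
  have "smooth_on U (coords y)"
    using smooth_on_subset[OF smooth_coords[OF V(1,2) smy] U(3)] .
  moreover have "U \<subseteq> W" using U(3) V(2) by blast
  ultimately show thesis
    using that[OF U(1,2) _ hom _ \<Phi> prof nf] by blast
qed

end

subsection \<open>Local coordinate systems\<close>

text \<open>\<open>chart_inv\<close> is an \<open>inv_into\<close>, which agrees with the given
  inverse on the image; this agreement transfers the homeomorphism property.\<close>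

lemma chart_from_homeomorphism:
  assumes "open U" "open B" "homeomorphism U B x y"
  shows "is_chart (U, x)" "chart_image (U, x) = B" "\<And>\<zeta>. \<zeta> \<in> B \<Longrightarrow> chart_inv (U, x) \<zeta> = y \<zeta>"
proof -
  show im: "chart_image (U, x) = B"
    using assms(3) by (simp add: chart_image_def homeomorphism_def)
  show inv: "chart_inv (U, x) \<zeta> = y \<zeta>" if "\<zeta> \<in> B" for \<zeta>
  proof -
    have "inj_on x U"
      using assms(3) by (metis homeomorphism_apply1 inj_onI)
    moreover have "y \<zeta> \<in> U" "x (y \<zeta>) = \<zeta>"
      using assms(3) that by (auto simp: homeomorphism_def)
    ultimately show ?thesis
      by (metis chart_inv_def fst_conv inv_into_f_f snd_conv)
  qed
  have "homeomorphism U B x (chart_inv (U, x))"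
    by (rule homeomorphism_cong[OF assms(3)]) (simp_all add: inv)
  then show "is_chart (U, x)"
    unfolding is_chart_def im using assms(1,2) by simp
qed

lemma is_chart_homeomorphism:
  "is_chart c \<Longrightarrow> homeomorphism (fst c) (chart_image c) (snd c) (chart_inv c)"
  by (simp add: is_chart_def)

lemma chart_inv_snd: "is_chart c \<Longrightarrow> m \<in> fst c \<Longrightarrow> chart_inv c (snd c m) = m"
  using is_chart_homeomorphism homeomorphism_apply1 by blast

lemma open_overlap:
  assumes c: "is_chart c" and c': "is_chart c'"
  shows "open (overlap c c')"
proof -
  note h = is_chart_homeomorphism[OF c]
  have "overlap c c' = chart_image c \<inter> chart_inv c -` fst c'"
    using h by (auto simp: overlap_def homeomorphism_def chart_image_def)
  then show ?thesis
    using continuous_open_preimage[of "chart_image c" "chart_inv c" "fst c'"] h c c'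
    by (simp add: homeomorphism_def is_chart_def)
qed

text \<open>Transition maps between the new chart and a chart of the atlas are transition maps of
  \<open>c\<close> composed with \<psi> or \<Phi>, hence smooth.\<close>

lemma local_coordinates_compose:
  assumes A: "smooth_atlas M A" and c: "c \<in> A"
    and U: "open U" "U \<subseteq> chart_image c" and B: "open B"
    and hom: "homeomorphism U B \<psi> \<Phi>" and \<psi>: "smooth_on U \<psi>" and \<Phi>: "smooth_on B \<Phi>"
  shows "(chart_inv c ` U, \<psi> \<circ> snd c) \<in> local_coordinates M A"
proof -
  let ?\<kappa> = "snd c" and ?\<kappa>' = "chart_inv c" and ?U = "chart_inv c ` U"
  define d where "d = (?U, \<psi> \<circ> ?\<kappa>)"
  have ch: "is_chart c'" if "c' \<in> A" for c'
    using A that by (simp add: smooth_atlas_def)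
  note h = is_chart_homeomorphism[OF ch[OF c]]
  have sub: "?U \<subseteq> fst c"
    using image_mono[OF U(2), of ?\<kappa>'] homeomorphism_image2[OF h] by simp
  have \<kappa>U: "?\<kappa> ` ?U = U"
    using homeomorphism_apply2[OF h] U(2) by (force simp: image_image subset_iff)
  have homU: "homeomorphism ?U U ?\<kappa> ?\<kappa>'"
    by (rule homeomorphism_of_subsets[OF h sub U(2) \<kappa>U])
  have "?U = fst c \<inter> ?\<kappa> -` U"
    using U(2) h sub \<kappa>U by (auto simp: homeomorphism_def) (metis imageI)
  then have oU: "open ?U"
    using continuous_open_preimage[of "fst c" ?\<kappa> U] h ch[OF c] U(1)
    by (simp add: homeomorphism_def is_chart_def)
  have hd: "homeomorphism ?U B (\<psi> \<circ> ?\<kappa>) (?\<kappa>' \<circ> \<Phi>)"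
    by (rule homeomorphism_compose[OF homU hom])
  note d = chart_from_homeomorphism[OF oU B hd, folded d_def]
  have dfst: "fst d = ?U" "snd d = \<psi> \<circ> ?\<kappa>"
    by (simp_all add: d_def)
  have \<Phi>\<psi>: "\<Phi> (\<psi> z) = z" if "z \<in> U" for z
    using hom that by (simp add: homeomorphism_def)
  have "compatible d c'" if c': "c' \<in> A" for c'
    unfolding compatible_def
  proof
    have comp: "compatible c c'"
      using A c c' by (simp add: smooth_atlas_def)
    have od: "overlap d c' \<subseteq> B" "\<Phi> ` overlap d c' \<subseteq> overlap c c'"
    proof -
      show "overlap d c' \<subseteq> B"
        using d(2) by (auto simp: overlap_def chart_image_def)
      show "\<Phi> ` overlap d c' \<subseteq> overlap c c'"
      proof
        fix z assume "z \<in> \<Phi> ` overlap d c'"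
        then obtain m where m: "m \<in> ?U" "m \<in> fst c'" "z = \<Phi> (\<psi> (?\<kappa> m))"
          by (auto simp: overlap_def dfst)
        then have "z = ?\<kappa> m"
          using \<Phi>\<psi> \<kappa>U by blast
        then show "z \<in> overlap c c'"
          using m(1,2) sub by (auto simp: overlap_def)
      qed
    qed
    have "smooth_on (overlap d c') (\<lambda>z. transition c c' (\<Phi> z))"
      by (rule smooth_on_compose[OF open_overlap[OF d(1) ch[OF c']] open_overlap[OF ch[OF c] ch[OF c']]
            od(2) smooth_on_subset[OF \<Phi> od(1)]])
        (use comp in \<open>simp add: compatible_def\<close>)
    then show "smooth_on (overlap d c') (transition d c')"
      by (subst smooth_on_cong[OF open_overlap[OF d(1) ch[OF c']], of _ "\<lambda>z. transition c c' (\<Phi> z)"])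
        (use od(1) d(3) in \<open>auto simp: transition_def\<close>)
    have od': "overlap c' d \<subseteq> overlap c' c"
      using sub by (auto simp: overlap_def dfst)
    have eq: "transition c' d z = \<psi> (transition c' c z)" for z
      by (simp add: transition_def dfst)
    have im: "transition c' c ` overlap c' d \<subseteq> U"
    proof
      fix z assume "z \<in> transition c' c ` overlap c' d"
      then obtain m where m: "m \<in> fst c'" "m \<in> ?U" "z = ?\<kappa> (chart_inv c' (snd c' m))"
        by (auto simp: overlap_def transition_def dfst)
      then have "z = ?\<kappa> m"
        using chart_inv_snd[OF ch[OF c']] by simp
      then show "z \<in> U"
        using m(2) \<kappa>U by blast
    qed
    have "smooth_on (overlap c' c) (transition c' c)"
      using comp by (simp add: compatible_def)
    then have "smooth_on (overlap c' d) (\<lambda>z. \<psi> (transition c' c z))"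
      by (intro smooth_on_compose[OF open_overlap[OF ch[OF c'] d(1)] U(1) im smooth_on_subset[OF _ od'] \<psi>])
    then show "smooth_on (overlap c' d) (transition c' d)"
      unfolding eq[abs_def] .
  qed
  moreover have "fst d \<subseteq> M"
    using A c sub dfst by (auto simp: smooth_atlas_def)
  ultimately show ?thesis
    using d(1) unfolding d_def local_coordinates_def by blast
qed

text \<open>All work takes place in one chart around \<open>p\<close>: on a ball in its image the
  eigen-conormals have constant directions, these determine the basis, and the coordinates found
  there are composed with the chart.\<close>

lemma normal_form_exists:
  fixes n :: nat and e :: "nat \<Rightarrow> 'd::finite"
    and M :: "'m::{t2_space, second_countable_topology} set" and A :: "('m, real^'d) chart set"
    and f C :: "'m \<Rightarrow> 'k::finite para_space"
  assumes n: "CARD('k) = n + 1" and e: "bij_betw e {1..2*n+1} (UNIV :: 'd set)"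
    and f: "affine_hypersurface M A f"
    and C: "in_charts A transversal_on f C" "in_charts A Jt_tangent_on f C"
    and par: "in_charts A phi_parallel_on f C \<or> in_charts A eta_parallel_on f C"
    and p: "p \<in> M"
  shows "\<exists>U x b v I \<alpha> P Q. p \<in> U \<and> (U, x) \<in> local_coordinates M A \<and>
    admissible_vectors n b v \<and> profile I \<alpha> P Q \<and>
    (\<forall>q\<in>U. x q $ e (2*n+1) \<in> I \<and> f q = normal_form n e b v P Q (x q))"
proof -
  have A: "smooth_atlas M A"
    using f by (simp add: affine_hypersurface_def)
  then obtain c where c: "c \<in> A" "p \<in> fst c"
    using p by (auto simp: smooth_atlas_def)
  define W g K where "W = chart_image c" and "g = f \<circ> chart_inv c" and "K = C \<circ> chart_inv c"
  have ch: "is_chart c"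
    using A c(1) by (simp add: smooth_atlas_def)
  have z0: "snd c p \<in> W"
    using c(2) by (simp add: W_def chart_image_def)
  interpret tangent_hypersurface W g K
  proof
    show "open W"
      using ch by (simp add: W_def is_chart_def)
    show "immersion_on W g" "DIM('k para_space) = CARD('d) + 1"
      using f c(1) by (simp_all only: affine_hypersurface_def W_def g_def)
    show "transversal_on W g K" "Jt_tangent_on W g K"
      using C c(1) by (simp_all add: in_charts_def W_def g_def K_def)
  qed
  have "phi_parallel_on W g K \<or> eta_parallel_on W g K"
    using par c(1) by (auto simp: in_charts_def W_def g_def K_def)
  from this z0 obtain r a a' \<rho> where r: "r > 0" "ball (snd c p) r \<subseteq> W"
    and a: "a \<noteq> 0" "a' \<noteq> 0" "Jt a = a" "Jt a' = - a'"
    and \<rho>: "\<forall>z\<in>ball (snd c p) r. \<rho> z > 0"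
      "\<forall>z\<in>ball (snd c p) r. \<forall>u. a' \<bullet> pushfwd g z u = - \<rho> z * (a \<bullet> pushfwd g z u)"
    by (rule constant_eigen_conormals)
  obtain b \<beta> v where b: "admissible_vectors n b v"
    and \<beta>: "\<forall>w. w = (\<Sum>i=1..2*n. (\<beta> i \<bullet> w) *\<^sub>R b i)
        + ((a \<bullet> w) / 2) *\<^sub>R (v + Jt v) + ((a' \<bullet> w) / 2) *\<^sub>R (v - Jt v)"
    by (rule adapted_basis[OF n a])
  interpret conormal_coordinates "ball (snd c p) r" g a a' n e b \<beta> v \<rho>
  proof
    show "inj (pushfwd g z)" if "z \<in> ball (snd c p) r" for z
      using inj_G r(2) that by blast
    show "\<rho> z > 0" "a' \<bullet> pushfwd g z u = - \<rho> z * (a \<bullet> pushfwd g z u)" if "z \<in> ball (snd c p) r" for z u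
      using \<rho> that by blast+
  qed (fact open_ball smooth_on_subset[OF smooth_g r(2)] e \<beta>[rule_format])+
  obtain U \<psi> \<Phi> s I \<alpha> P Q where U: "open U" "snd c p \<in> U" "U \<subseteq> ball (snd c p) r"
    and hom: "homeomorphism U (ball (\<psi> (snd c p)) s) \<psi> \<Phi>"
    and sm: "smooth_on U \<psi>" "smooth_on (ball (\<psi> (snd c p)) s) \<Phi>" and prof: "profile I \<alpha> P Q"
    and nf: "\<And>z. z \<in> U \<Longrightarrow> \<psi> z $ e (2*n+1) \<in> I \<and> g z = normal_form n e b v P Q (\<psi> z)"
    using normal_form_coordinates[of "snd c p"] r(1) by (metis centre_in_ball)
  have UW: "U \<subseteq> chart_image c"
    using U(3) r(2) W_def by blast
  show ?thesis
  proof (intro exI conjI)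
    show "(chart_inv c ` U, \<psi> \<circ> snd c) \<in> local_coordinates M A"
      by (rule local_coordinates_compose[OF A c(1) U(1) UW open_ball hom sm])
    show "p \<in> chart_inv c ` U"
      using U(2) chart_inv_snd[OF ch c(2)] by force
    show "\<forall>q\<in>chart_inv c ` U. (\<psi> \<circ> snd c) q $ e (2*n+1) \<in> I \<and> f q = normal_form n e b v P Q ((\<psi> \<circ> snd c) q)"
    proof
      fix q assume "q \<in> chart_inv c ` U"
      then obtain z where z: "z \<in> U" "q = chart_inv c z" by blast
      then have "snd c q = z"
        using is_chart_homeomorphism[OF ch] UW homeomorphism_apply2 by blast
      then show "(\<psi> \<circ> snd c) q $ e (2*n+1) \<in> I \<and> f q = normal_form n e b v P Q ((\<psi> \<circ> snd c) q)"
        using nf[OF z(1)] z(2) by (simp add: g_def)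
    qed
  qed (fact b prof)+
qed

subsection \<open>The hypersurfaces in normal form\<close>

lemma (in tangent_hypersurface) transversal_part_eq:
  assumes "z \<in> W"
  shows "transversal_part g C z (pushfwd g z u + r *\<^sub>R C z) = r"
  unfolding transversal_part_def
proof (rule the_equality)
  fix r' assume "\<exists>u'. pushfwd g z u + r *\<^sub>R C z = pushfwd g z u' + r' *\<^sub>R C z"
  then obtain u' where "pushfwd g z u + r *\<^sub>R C z = pushfwd g z u' + r' *\<^sub>R C z" by blast
  then have "conormal z \<bullet> (pushfwd g z u + r *\<^sub>R C z) = conormal z \<bullet> (pushfwd g z u' + r' *\<^sub>R C z)"
    by simp
  then show "r' = r"
    by (simp add: inner_add_right conormal_G[OF assms] conormal_C[OF assms])
qed blast

text \<open>Turns independence of a set of vectors into a statement on indexed coefficients.\<close>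

lemma admissible_coefficients_zero:
  assumes b: "admissible_vectors n b v"
    and eq: "(\<Sum>i=1..2*n. c i *\<^sub>R b i) + s *\<^sub>R Jt v + t *\<^sub>R v = 0"
  shows "\<And>i. i \<in> {1..2*n} \<Longrightarrow> c i = 0" "s = 0" "t = 0"
proof -
  let ?I = "{1..2*n}"
  have up: "set [1..<2*n+1] = ?I"
    by (simp only: set_upt) auto
  have "distinct (map b [1..<2*n+1] @ [v, Jt v])" "independent (set (map b [1..<2*n+1] @ [v, Jt v]))"
    using b unfolding admissible_vectors_def Let_def by blast+
  then have inj: "inj_on b ?I" and v: "v \<notin> b ` ?I" "Jt v \<notin> b ` ?I" "v \<noteq> Jt v"
    and ind: "independent (insert v (insert (Jt v) (b ` ?I)))"
    unfolding distinct_append distinct_map set_append set_map up by (auto simp: insert_commute)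
  \<comment> \<open>The coefficients as a function of the vector, which recovers each given
    coefficient because the list of vectors is distinct.\<close>
  define k where "k w = (if w = v then t else if w = Jt v then s else c (the_inv_into ?I b w))" for w
  have kb: "k (b i) = c i" if "i \<in> ?I" for i
  proof -
    have "b i \<noteq> v" "b i \<noteq> Jt v"
      using that v(1,2) by (metis imageI)+
    then show ?thesis
      by (simp only: k_def the_inv_into_f_f[OF inj that] if_False)
  qed
  have "(\<Sum>w\<in>b ` ?I. k w *\<^sub>R w) = (\<Sum>i\<in>?I. c i *\<^sub>R b i)"
    by (subst sum.reindex[OF inj]) (simp add: kb)
  then have "(\<Sum>w\<in>insert v (insert (Jt v) (b ` ?I)). k w *\<^sub>R w) = 0"
    using v eq by (simp add: k_def add.commute add.left_commute)
  then have k0: "k w = 0" if "w \<in> insert v (insert (Jt v) (b ` ?I))" for w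
    using ind independentD[OF ind _ order_refl _ that] by blast
  show "c i = 0" if "i \<in> ?I" for i
    using k0[of "b i"] kb[OF that] that by auto
  show "s = 0" "t = 0"
    using k0[of v] k0[of "Jt v"] v(3) by (auto simp: k_def)
qed

section \<open>Differential of the normal form and its transversal field\<close>

locale normal_form_hypersurface =
  fixes n :: nat and e :: "nat \<Rightarrow> 'd::finite" and b :: "nat \<Rightarrow> 'k::finite para_space" and v :: "'k para_space"
    and I :: "real set" and \<alpha> P Q :: "real \<Rightarrow> real" and W :: "(real^'d) set" and f :: "real^'d \<Rightarrow> 'k para_space"
  assumes n: "CARD('k) = n + 1" and e: "bij_betw e {1..2*n+1} (UNIV :: 'd set)"
    and b: "admissible_vectors n b v" and prof: "profile I \<alpha> P Q"
    and W: "open W" "\<And>z. z \<in> W \<Longrightarrow> z $ e (2*n+1) \<in> I"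
    and f: "\<And>z. z \<in> W \<Longrightarrow> f z = normal_form n e b v P Q z"
begin

definition "m = e (2*n+1)"

definition ch :: "real^'d \<Rightarrow> real" where "ch z = cosh (\<alpha> (z $ m))"
definition sh :: "real^'d \<Rightarrow> real" where "sh z = sinh (\<alpha> (z $ m))"

text \<open>The closed form of the differential of \<open>f\<close> on \<open>W\<close>; the bracket
  is the derivative of \<open>f\<close> along \<open>y\<close>.\<close>

definition D :: "real^'d \<Rightarrow> real^'d \<Rightarrow> 'k para_space" where
  "D z u = (\<Sum>i=1..2*n. (u $ e i) *\<^sub>R b i) + (u $ m) *\<^sub>R (ch z *\<^sub>R Jt v + sh z *\<^sub>R v)"

text \<open>J applied to the derivative of \<open>f\<close> along \<open>y\<close>.\<close>

definition K :: "real^'d \<Rightarrow> 'k para_space" where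
  "K z = ch z *\<^sub>R v + sh z *\<^sub>R Jt v"

lemma W_I: "z \<in> W \<Longrightarrow> z $ m \<in> I"
  using W(2) by (simp add: m_def)

lemma e_neq_m: "i \<in> {1..2*n} \<Longrightarrow> e i \<noteq> m"
  using e by (auto simp: m_def bij_betw_def dest: inj_onD)

lemma index_cases:
  obtains "j = m" | i where "i \<in> {1..2*n}" "j = e i"
proof -
  obtain i where i: "i \<in> {1..2*n+1}" "j = e i"
    using e by (metis UNIV_I bij_betw_imp_surj_on imageE)
  then show thesis
  proof (cases "i = 2*n+1")
    case True
    then show thesis using that(1) i(2) unfolding m_def by blast
  next
    case False
    then have "i \<in> {1..2*n}" using i(1) by auto
    then show thesis using that(2) i(2) by blast
  qed
qed

lemma profile_smooth:
  "open I" "smooth_on I \<alpha>" "smooth_on I P" "smooth_on I Q"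
proof -
  show I: "open I" and \<alpha>: "smooth_on I \<alpha>"
    using prof by (auto simp: profile_def)
  have c: "smooth_on I (\<lambda>t. cosh (\<alpha> t))" and s: "smooth_on I (\<lambda>t. sinh (\<alpha> t))"
    using hd_on_cosh_sinh[OF I smooth_onD[OF \<alpha>]] by (auto intro: smooth_onI)
  show "smooth_on I P"
    by (rule smooth_primitive[OF I _ c]) (use prof in \<open>auto simp: profile_def\<close>)
  show "smooth_on I Q"
    by (rule smooth_primitive[OF I _ s]) (use prof in \<open>auto simp: profile_def\<close>)
qed

lemma hd_on_coordinate: "hd_on k W (\<lambda>z. z $ j)"
  by (rule hd_on_linear_map[OF W(1) bounded_linear_vec_nth])

lemma smooth_on_coordinate_compose:
  fixes F :: "real \<Rightarrow> real"
  assumes "smooth_on I F"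
  shows "smooth_on W (\<lambda>z. F (z $ m))"
  by (rule smooth_on_compose[OF W(1) profile_smooth(1) _ smooth_onI[OF hd_on_coordinate] assms]) (use W_I in auto)

lemma smooth_ch_sh: "smooth_on W ch" "smooth_on W sh"
  using hd_on_cosh_sinh[OF W(1) smooth_onD[OF smooth_on_coordinate_compose[OF profile_smooth(2)]]]
  by (auto intro!: smooth_onI simp: ch_def[abs_def] sh_def[abs_def])

lemma smooth_f: "smooth_on W f"
proof -
  have "smooth_on W (normal_form n e b v P Q)"
    unfolding normal_form_def[abs_def] m_def[symmetric]
    by (intro smooth_onI hd_on_add hd_on_sum hd_on_scaleR hd_on_const hd_on_coordinate W(1)
        smooth_onD[OF smooth_on_coordinate_compose] profile_smooth)
  then show ?thesis
    using smooth_on_cong[OF W(1), of f "normal_form n e b v P Q"] f by blast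
qed

lemma smooth_K: "smooth_on W K"
  unfolding K_def[abs_def]
  by (intro smooth_onI hd_on_add hd_on_scaleR hd_on_const W(1) smooth_ch_sh[THEN smooth_onD])

lemma has_derivative_coordinate_compose:
  fixes F :: "real \<Rightarrow> real"
  assumes "(F has_real_derivative d) (at (z $ m))"
  shows "((\<lambda>z. F (z $ m)) has_derivative (\<lambda>u. d * (u $ m))) (at z)"
proof -
  have "((\<lambda>z. z $ m) has_derivative (\<lambda>u. u $ m)) (at z)"
    by (rule bounded_linear_imp_has_derivative[OF bounded_linear_vec_nth])
  from has_derivative_compose[OF this, of F "(*) d"] assms show ?thesis
    by (simp add: has_field_derivative_def)
qed

lemma pushfwd_f:
  assumes z: "z \<in> W"
  shows "pushfwd f z = D z"
proof -
  have "(P has_real_derivative ch z) (at (z $ m))" "(Q has_real_derivative sh z) (at (z $ m))"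
    using prof W_I[OF z] by (auto simp: profile_def ch_def sh_def)
  note PQ = this[THEN has_derivative_coordinate_compose]
  have "((\<lambda>z. (\<Sum>i=1..2*n. (z $ e i) *\<^sub>R b i) + P (z $ m) *\<^sub>R Jt v + Q (z $ m) *\<^sub>R v) has_derivative
      (\<lambda>u. (\<Sum>i=1..2*n. (u $ e i) *\<^sub>R b i) + (ch z * (u $ m)) *\<^sub>R Jt v + (sh z * (u $ m)) *\<^sub>R v)) (at z)"
    by (intro has_derivative_add has_derivative_sum has_derivative_scaleR_left PQ
        bounded_linear_imp_has_derivative[OF bounded_linear_vec_nth])
  moreover have "(\<lambda>u. (\<Sum>i=1..2*n. (u $ e i) *\<^sub>R b i) + (ch z * (u $ m)) *\<^sub>R Jt v + (sh z * (u $ m)) *\<^sub>R v) = D z"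
    by (simp add: D_def[abs_def] algebra_simps)
  ultimately have "(f has_derivative D z) (at z)"
    using has_derivative_transform_within_open[OF _ W(1) z, of _ "D z" UNIV f]
    by (simp add: f normal_form_def m_def)
  then show ?thesis by (rule frechet_derivative_eq)
qed

lemma D_axis: "D z (axis m 1) = Jt (K z)"
proof -
  have "(\<Sum>i=1..2*n. (axis m (1::real) $ e i) *\<^sub>R b i) = 0"
    by (rule sum.neutral) (use e_neq_m in \<open>auto simp: axis_def\<close>)
  then show ?thesis
    by (simp add: D_def K_def Jt_simps axis_def)
qed

lemma ch_sh: "ch z * ch z - sh z * sh z = 1"
  using cosh_square_eq[of "\<alpha> (z $ m)"] by (simp add: ch_def sh_def power2_eq_square)

lemma linear_D: "linear (D z)"
  by (rule linearI) (simp_all add: D_def sum.distrib scaleR_sum_right algebra_simps)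

text \<open>With respect to \<open>Jt v\<close> and \<open>v\<close>, the derivative of
  \<open>f\<close> along \<open>y\<close> and the field \<open>K\<close> have coefficients (cosh,
  sinh) and (sinh, cosh). The determinant is 1, so they are independent of each other and of the
  \<open>b i\<close>.\<close>

lemma D_eq_0: "D z u + r *\<^sub>R K z = 0 \<Longrightarrow> u = 0 \<and> r = 0"
proof -
  assume "D z u + r *\<^sub>R K z = 0"
  then have "(\<Sum>i=1..2*n. (u $ e i) *\<^sub>R b i) + (u $ m * ch z + r * sh z) *\<^sub>R Jt v + (u $ m * sh z + r * ch z) *\<^sub>R v = 0"
    by (simp add: D_def K_def algebra_simps)
  note z = admissible_coefficients_zero[OF b this]
  \<comment> \<open>Inverts the two-by-two system of the coefficients of \<open>Jt v\<close> and
    \<open>v\<close>, both of which vanish.\<close>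
  have "u $ m = (u $ m * ch z + r * sh z) * ch z - (u $ m * sh z + r * ch z) * sh z"
    using arg_cong[OF ch_sh[of z], of "\<lambda>x. u $ m * x"] by (simp add: algebra_simps)
  moreover have "r = (u $ m * sh z + r * ch z) * ch z - (u $ m * ch z + r * sh z) * sh z"
    using arg_cong[OF ch_sh[of z], of "\<lambda>x. r * x"] by (simp add: algebra_simps)
  ultimately have "u $ m = 0" "r = 0"
    unfolding z by simp_all
  moreover have "u $ j = 0" for j
    by (cases j rule: index_cases) (use z(1) \<open>u $ m = 0\<close> in simp_all)
  ultimately show ?thesis
    by (simp add: vec_eq_iff)
qed

lemma dim: "DIM('k para_space) = CARD('d) + 1"
  using n bij_betw_same_card[OF e] by simp

sublocale tangent_hypersurface W f K
proof
  show "open W" by (rule W(1))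
  have "inj (D z)" for z
    using D_eq_0[of z _ 0] linear_injective_0[OF linear_D] by simp
  then show "immersion_on W f"
    by (simp add: immersion_on_def smooth_f pushfwd_f)
  have "K z \<noteq> D z u" for z u
    using D_eq_0[of z u "-1"] by auto
  then show "transversal_on W f K"
    by (auto simp: transversal_on_def smooth_K pushfwd_f)
  show "Jt_tangent_on W f K"
    by (auto simp: Jt_tangent_on_def pushfwd_f simp flip: D_axis)
  show "DIM('k para_space) = CARD('d) + 1" by (rule dim)
qed

section \<open>Induced connection and parallelity of the structure\<close>

lemma derivative_alpha:
  assumes "z \<in> W"
  obtains d where "(\<alpha> has_real_derivative d) (at (z $ m))"
  using smooth_on_has_derivative[OF profile_smooth(2) W_I[OF assms]] differentiable_def real_differentiable_def
  by blast

lemma derivative_ch_sh: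
  assumes z: "z \<in> W"
  obtains d where "(ch has_derivative (\<lambda>u. (d * (u $ m)) * sh z)) (at z)"
    "(sh has_derivative (\<lambda>u. (d * (u $ m)) * ch z)) (at z)"
proof -
  obtain d where d: "(\<alpha> has_real_derivative d) (at (z $ m))"
    using derivative_alpha[OF z] .
  have "((\<lambda>t. cosh (\<alpha> t)) has_real_derivative d * sh z) (at (z $ m))"
    "((\<lambda>t. sinh (\<alpha> t)) has_real_derivative d * ch z) (at (z $ m))"
    using d by (auto intro!: derivative_eq_intros simp: sh_def ch_def)
  from this[THEN has_derivative_coordinate_compose] show thesis
    by (intro that[of d]) (simp_all add: ch_def[abs_def] sh_def[abs_def] mult_ac)
qed

text \<open>Differentiation interchanges cosh and sinh up to the factor \<alpha>', so the derivative
  of \<open>K\<close> is a multiple of \<open>Jt (K z)\<close>, which is tangent.\<close>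

lemma equiaffine: "equiaffine_on W f K"
  unfolding equiaffine_on_def
proof (intro ballI allI)
  fix z u assume z: "z \<in> W"
  obtain d where d: "(ch has_derivative (\<lambda>u. (d * (u $ m)) * sh z)) (at z)"
    "(sh has_derivative (\<lambda>u. (d * (u $ m)) * ch z)) (at z)"
    using derivative_ch_sh[OF z] .
  have "(K has_derivative (\<lambda>u. ((d * (u $ m)) * sh z) *\<^sub>R v + ((d * (u $ m)) * ch z) *\<^sub>R Jt v)) (at z)"
    unfolding K_def[abs_def] by (intro has_derivative_add has_derivative_scaleR_left d)
  then have "frechet_derivative K (at z) u = (d * (u $ m)) *\<^sub>R Jt (K z)"
    by (simp add: frechet_derivative_eq K_def Jt_simps algebra_simps)
  also have "\<dots> = pushfwd f z ((d * (u $ m)) *\<^sub>R axis m 1) + 0 *\<^sub>R K z"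
    by (simp add: pushfwd_f[OF z] linear_scale[OF linear_D] D_axis)
  finally show "transversal_form f K z u = 0"
    unfolding transversal_form_def by (simp only: transversal_part_eq[OF z])
qed

text \<open>The only second derivative of \<open>f\<close> that can be nonzero is the one taken
  twice along \<open>y\<close>, and it is a multiple of \<open>K\<close>. So the induced connection
  is componentwise differentiation. \<open>Z\<close> is separate from \<open>Y\<close> because the
  structure tensors have closed forms on \<open>W\<close> only.\<close>

lemma nabla_eq:
  assumes z: "z \<in> W" and Y: "(Y has_derivative Y') (at z)" and eq: "\<And>z. z \<in> W \<Longrightarrow> Z z = Y z"
  shows "nabla f K X Z z = Y' (X z)"
proof -
  obtain d where d: "(ch has_derivative (\<lambda>u. (d * (u $ m)) * sh z)) (at z)"
    "(sh has_derivative (\<lambda>u. (d * (u $ m)) * ch z)) (at z)"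
    using derivative_ch_sh[OF z] .
  have c: "((\<lambda>z. Y z $ j) has_derivative (\<lambda>u. Y' u $ j)) (at z)" for j
    by (rule bounded_linear.has_derivative[OF bounded_linear_vec_nth Y])
  have "((\<lambda>z. D z (Y z)) has_derivative (\<lambda>u. (\<Sum>i=1..2*n. (Y' u $ e i) *\<^sub>R b i)
      + ((Y z $ m) *\<^sub>R (((d * (u $ m)) * sh z) *\<^sub>R Jt v + ((d * (u $ m)) * ch z) *\<^sub>R v)
         + (Y' u $ m) *\<^sub>R (ch z *\<^sub>R Jt v + sh z *\<^sub>R v)))) (at z)"
    unfolding D_def
    by (intro has_derivative_add has_derivative_sum has_derivative_scaleR_left has_derivative_scaleR c d)
  then have "((\<lambda>z. pushfwd f z (Z z)) has_derivative (\<lambda>u. (\<Sum>i=1..2*n. (Y' u $ e i) *\<^sub>R b i)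
      + ((Y z $ m) *\<^sub>R (((d * (u $ m)) * sh z) *\<^sub>R Jt v + ((d * (u $ m)) * ch z) *\<^sub>R v)
         + (Y' u $ m) *\<^sub>R (ch z *\<^sub>R Jt v + sh z *\<^sub>R v)))) (at z)"
    by (rule has_derivative_transform_within_open[OF _ W(1) z]) (simp add: pushfwd_f eq)
  then have "flat_deriv X (\<lambda>z. pushfwd f z (Z z)) z
      = pushfwd f z (Y' (X z)) + (Y z $ m * d * (X z $ m)) *\<^sub>R K z"
    unfolding flat_deriv_def pushfwd_f[OF z]
    by (simp add: frechet_derivative_eq D_def K_def algebra_simps)
  then show ?thesis
    unfolding nabla_def using tangential_part_eq[OF z] by simp
qed

lemma xi_eq: "z \<in> W \<Longrightarrow> xi_field f K z = axis m 1"
  using G_xi inj_G D_axis pushfwd_f by (metis injD)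

text \<open>The diagonal matrix of \<phi>: entries 1 and -1 for the eigenvectors \<open>b i\<close>
  of J, and 0 for the direction of \<xi>.\<close>

definition phi_matrix :: "real^'d \<Rightarrow> real^'d" where
  "phi_matrix u = (\<chi> j. if j = m then 0 else if the_inv_into {1..2*n+1} e j \<le> n then u $ j else - (u $ j))"

lemma phi_matrix_m: "phi_matrix u $ m = 0"
  by (simp add: phi_matrix_def)

lemma phi_matrix_e:
  assumes "i \<in> {1..2*n}"
  shows "phi_matrix u $ e i = (if i \<le> n then u $ e i else - (u $ e i))"
proof -
  have "inj_on e {1..2*n+1}"
    using e by (simp add: bij_betw_def)
  then have "the_inv_into {1..2*n+1} e (e i) = i"
    using assms by (intro the_inv_into_f_f) auto
  then show ?thesis
    using e_neq_m[OF assms] by (simp add: phi_matrix_def)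
qed

lemma linear_phi_matrix: "linear phi_matrix"
  by (rule linearI) (auto simp: phi_matrix_def vec_eq_iff)

text \<open>J acts on the \<open>b i\<close> by signs and sends the derivative along
  \<open>y\<close> to \<open>K\<close>. This splits the J-image of a tangent vector into its
  tangential and transversal parts, from which \<phi> and \<eta> are read off.\<close>

lemma Jt_D: "Jt (D z u) = D z (phi_matrix u) + (u $ m) *\<^sub>R K z"
proof -
  have "Jt (b i) = (if i \<le> n then b i else - b i)" if "i \<in> {1..2*n}" for i
    using b that unfolding admissible_vectors_def by (cases "i \<le> n") auto
  then have "Jt (\<Sum>i=1..2*n. (u $ e i) *\<^sub>R b i) = (\<Sum>i=1..2*n. (phi_matrix u $ e i) *\<^sub>R b i)"
    unfolding linear_sum[OF linear_Jt] by (intro sum.cong) (auto simp: Jt_simps phi_matrix_e)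
  then show ?thesis
    by (simp add: D_def K_def Jt_simps phi_matrix_m)
qed

lemma eta_eq:
  assumes z: "z \<in> W"
  shows "eta_form f K z u = u $ m"
  using conormal_G[OF z] conormal_C[OF z]
  by (simp add: eta_form_eq[OF z] pushfwd_f[OF z] Jt_D inner_add_right)

lemma phi_eq:
  assumes z: "z \<in> W"
  shows "phi_tensor f K z u = phi_matrix u"
  using G_phi[OF z, of u] inj_G[OF z] by (simp add: eta_eq[OF z] pushfwd_f[OF z] Jt_D inj_eq)

text \<open>Componentwise differentiation commutes with the constant matrix of \<phi>.\<close>

lemma phi_parallel: "phi_parallel_on W f K"
  unfolding phi_parallel_on_def
proof (intro allI impI ballI)
  fix X Y :: "real^'d \<Rightarrow> real^'d" and z assume Y: "smooth_on W Y" and z: "z \<in> W"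
  note dY = smooth_on_has_derivative[OF Y z]
  have "((\<lambda>z. phi_matrix (Y z)) has_derivative (\<lambda>u. phi_matrix (frechet_derivative Y (at z) u))) (at z)"
    by (rule bounded_linear.has_derivative[OF _ dY]) (simp add: linear_phi_matrix linear_linear)
  from nabla_eq[OF z this, of "\<lambda>z. phi_tensor f K z (Y z)" X] nabla_eq[OF z dY refl, of X]
  show "nabla f K X (\<lambda>z. phi_tensor f K z (Y z)) z - phi_tensor f K z (nabla f K X Y z) = 0"
    by (simp add: phi_eq z)
qed

lemma eta_parallel: "eta_parallel_on W f K"
  unfolding eta_parallel_on_def
proof (intro allI impI ballI)
  fix X Y :: "real^'d \<Rightarrow> real^'d" and z assume Y: "smooth_on W Y" and z: "z \<in> W"
  note dY = smooth_on_has_derivative[OF Y z]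
  have "((\<lambda>z. Y z $ m) has_derivative (\<lambda>u. frechet_derivative Y (at z) u $ m)) (at z)"
    by (rule bounded_linear.has_derivative[OF bounded_linear_vec_nth dY])
  then have "((\<lambda>z. eta_form f K z (Y z)) has_derivative (\<lambda>u. frechet_derivative Y (at z) u $ m)) (at z)"
    by (rule has_derivative_transform_within_open[OF _ W(1) z]) (simp add: eta_eq)
  then show "flat_deriv X (\<lambda>z. eta_form f K z (Y z)) z - eta_form f K z (nabla f K X Y z) = 0"
    using nabla_eq[OF z dY refl, of X] by (simp add: flat_deriv_def frechet_derivative_eq eta_eq[OF z])
qed

lemma xi_parallel: "xi_parallel_on W f K"
  unfolding xi_parallel_on_def
  using nabla_eq[OF _ has_derivative_const[of "axis m 1"], of _ "xi_field f K"] xi_eq by blast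

end

section \<open>The normal form and its converse\<close>

theorem theorem4p11:
  fixes n :: nat and e :: "nat \<Rightarrow> 'd::finite"
  assumes "CARD('k::finite) = n + 1"
    and "bij_betw e {1..2*n+1} (UNIV :: 'd set)"
  shows
   "(\<forall>(M :: 'm::{t2_space, second_countable_topology} set) (A :: ('m, real^'d) chart set)
       (f :: 'm \<Rightarrow> 'k para_space) (C :: 'm \<Rightarrow> 'k para_space).
       affine_hypersurface M A f \<and> in_charts A transversal_on f C \<and> in_charts A Jt_tangent_on f C \<and>
       (in_charts A phi_parallel_on f C \<or> in_charts A eta_parallel_on f C)
       \<longrightarrow> (\<forall>p\<in>M. \<exists>U x b v I \<alpha> P Q.
             p \<in> U \<and> (U, x) \<in> local_coordinates M A \<and>
             admissible_vectors n b v \<and> profile I \<alpha> P Q \<and>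
             (\<forall>q\<in>U. x q $ e (2*n+1) \<in> I \<and> f q = normal_form n e b v P Q (x q))))
    \<and>
    (\<forall>(b :: nat \<Rightarrow> 'k para_space) v I \<alpha> P Q (W :: (real^'d) set) (f :: real^'d \<Rightarrow> 'k para_space).
       admissible_vectors n b v \<and> profile I \<alpha> P Q \<and>
       open W \<and> connected W \<and> (\<forall>z\<in>W. z $ e (2*n+1) \<in> I) \<and>
       (\<forall>z\<in>W. f z = normal_form n e b v P Q z)
       \<longrightarrow> immersion_on W f \<and>
           (\<exists>C. transversal_on W f C \<and> Jt_tangent_on W f C \<and> equiaffine_on W f C \<and>
                phi_parallel_on W f C \<and> eta_parallel_on W f C \<and> xi_parallel_on W f C))"
proof (intro conjI allI impI ballI)
  fix M :: "'m set" and A :: "('m, real^'d) chart set" and f C :: "'m \<Rightarrow> 'k para_space" and p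
  assume "affine_hypersurface M A f \<and> in_charts A transversal_on f C \<and> in_charts A Jt_tangent_on f C \<and>
       (in_charts A phi_parallel_on f C \<or> in_charts A eta_parallel_on f C)" and "p \<in> M"
  then show "\<exists>U x b v I \<alpha> P Q.
             p \<in> U \<and> (U, x) \<in> local_coordinates M A \<and>
             admissible_vectors n b v \<and> profile I \<alpha> P Q \<and>
             (\<forall>q\<in>U. x q $ e (2*n+1) \<in> I \<and> f q = normal_form n e b v P Q (x q))"
    by (elim conjE) (rule normal_form_exists[OF assms])
next
  fix b :: "nat \<Rightarrow> 'k para_space" and v I \<alpha> P Q and W :: "(real^'d) set" and f :: "real^'d \<Rightarrow> 'k para_space"
  assume "admissible_vectors n b v \<and> profile I \<alpha> P Q \<and>
       open W \<and> connected W \<and> (\<forall>z\<in>W. z $ e (2*n+1) \<in> I) \<and>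
       (\<forall>z\<in>W. f z = normal_form n e b v P Q z)"
  then interpret normal_form_hypersurface n e b v I \<alpha> P Q W f
    by unfold_locales (use assms in auto)
  show "immersion_on W f" by (rule immersion)
  show "\<exists>C. transversal_on W f C \<and> Jt_tangent_on W f C \<and> equiaffine_on W f C \<and>
                phi_parallel_on W f C \<and> eta_parallel_on W f C \<and> xi_parallel_on W f C"
    \<comment> \<open>The witness for \<open>C\<close> is \<open>K\<close>.\<close>
    using transversal tangent equiaffine phi_parallel eta_parallel xi_parallel by blast
qed

end
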